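(* Let $r\ge 2$ be an integer and $\alpha\in(0,1)$. The sequence $(p_n^{r,1})_{n\ge0}$ is (i) (strictly) increasing when $0<\alpha\le\frac1{2r}$; (ii) unimodal when $\frac1{2r}<\alpha\le\frac1{r+1}$; (iii) (strictly) decreasing when $\frac1{r+1}<\alpha<1$. In addition, for fixed $r$, the mode $N_{\alpha,r}$ in case (ii) satisfies $$N_{\alpha,r}\sim\frac{r-1}{4r}\Bigl(\alpha-\frac1{2r}\Bigr)^{-1}\quad\text{as }\alpha\downarrow\frac1{2r},$$ while for the maximum $$p_{N_{\alpha,r}}^{r,1}-\frac12\sim\frac43\sqrt{\frac{r^5}{\pi(2r-1)(r-1)}}\,\Bigl(\alpha-\frac1{2r}\Bigr)^{3/2}\quad\text{as }\alpha\downarrow\frac1{2r}.$$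
   Context: Let $\{X_i,X_i'\}_{i\ge1}$ be independent identically distributed random variables with $\mathbb{P}\{X_i=1\}=\alpha$ and $\mathbb{P}\{X_i=0\}=1-\alpha$. Put $S_k=X_1+\dots+X_k$ and $S_n'=X_1'+\dots+X_n'$ (with $S_0=S_0'=0$), so that $S_k$ and $S_n'$ are independent binomial random variables. For integers $r,d\ge1$ and $n\ge0$ define $p_n^{r,d}:=\mathbb{P}\{S_{n+r}\ge S_n'+d\}$ (this depends on $\alpha$). "Increasing/decreasing" mean strictly increasing/strictly decreasing. A sequence $(a_n)_{n\ge0}$ is unimodal with mode $N\ge1$ if $a_0<a_1<\dots<a_{N-1}\le a_N>a_{N+1}>a_{N+2}>\cdots$. The notation $f\sim g$ means that $f/g\to1$. *)

theory Defs
  imports "HOL-Probability.Probability" "HOL-Library.Landau_Symbols"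
begin

text \<open>
  Two sequences \<open>X\<^sub>1, X\<^sub>2, \<dots>\<close> and \<open>X'\<^sub>1, X'\<^sub>2, \<dots>\<close>, indexed from 1. Independence is that of the
  combined family; the disjoint sum of the index sets keeps the two sequences apart.
\<close>

definition iid_bernoulli ::
  "'a measure \<Rightarrow> real \<Rightarrow> (nat \<Rightarrow> 'a \<Rightarrow> real) \<Rightarrow> (nat \<Rightarrow> 'a \<Rightarrow> real) \<Rightarrow> bool" where
  "iid_bernoulli M \<alpha> X X' \<longleftrightarrow>
     prob_space M \<and>
     prob_space.indep_vars M (\<lambda>_. borel) (case_sum X X') ({1..} <+> {1..}) \<and>
     (\<forall>i\<ge>1. \<P>(\<omega> in M. X i \<omega> = 1) = \<alpha> \<and> \<P>(\<omega> in M. X i \<omega> = 0) = 1 - \<alpha>) \<and>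
     (\<forall>i\<ge>1. \<P>(\<omega> in M. X' i \<omega> = 1) = \<alpha> \<and> \<P>(\<omega> in M. X' i \<omega> = 0) = 1 - \<alpha>)"

lemma iid_bernoulli_exists:
  assumes "0 < \<alpha>" "\<alpha> < 1"
  shows "\<exists>(M :: (nat + nat \<Rightarrow> real) measure) X X'. iid_bernoulli M \<alpha> X X'"
proof -
  define B where "B = distr (measure_pmf (bernoulli_pmf \<alpha>)) borel (of_bool :: bool \<Rightarrow> real)"
  define M where "M = PiM (UNIV :: (nat + nat) set) (\<lambda>_. B)"
  have pB: "prob_space B" unfolding B_def by (rule prob_space.prob_space_distr) (auto simp: measure_pmf.prob_space_axioms)
  have sB[measurable_cong]: "sets B = sets borel" by (simp add: B_def)
  interpret M: prob_space M unfolding M_def by (rule prob_space_PiM) (rule pB)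
  have rv: "(\<lambda>\<omega>. \<omega> i) \<in> M \<rightarrow>\<^sub>M borel" for i unfolding M_def by measurable
  have dc: "distr M borel (\<lambda>\<omega>. \<omega> i) = B" for i
    using distr_PiM_component[of UNIV "\<lambda>_. B" i] pB distr_cong[of M M borel B "\<lambda>\<omega>. \<omega> i" "\<lambda>\<omega>. \<omega> i"] sB by (simp add: M_def)
  have "M.indep_vars (\<lambda>_. borel) (\<lambda>i \<omega>. \<omega> i) UNIV"
  proof (subst M.indep_vars_iff_distr_eq_PiM)
    have "distr M (PiM UNIV (\<lambda>_. borel)) (\<lambda>x. \<lambda>i\<in>UNIV. x i) = distr M M (\<lambda>x. x)"
      by (rule distr_cong) (auto simp: M_def intro!: sets_PiM_cong simp: sB)
    then show "distr M (PiM UNIV (\<lambda>_. borel)) (\<lambda>x. \<lambda>i\<in>UNIV. x i) = PiM UNIV (\<lambda>i. distr M borel (\<lambda>\<omega>. \<omega> i))"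
      unfolding dc by (simp add: M_def[symmetric])
  qed (use rv in auto)
  then have ind: "M.indep_vars (\<lambda>_. borel) (case_sum (\<lambda>i \<omega>. \<omega> (Inl i)) (\<lambda>i \<omega>. \<omega> (Inr i))) ({1..} <+> {1..})"
    by (rule M.indep_vars_subset[THEN M.indep_vars_cong[THEN iffD1, rotated -1]]) (auto split: sum.splits)
  have pr: "\<P>(\<omega> in M. \<omega> i = c) = measure_pmf.prob (bernoulli_pmf \<alpha>) {b. of_bool b = c}" for i c
  proof -
    have "\<P>(\<omega> in M. \<omega> i = c) = measure (distr M borel (\<lambda>\<omega>. \<omega> i)) {c}"
      by (subst measure_distr) (auto simp: rv intro!: arg_cong2[where f=measure])
    also have "\<dots> = measure_pmf.prob (bernoulli_pmf \<alpha>) {b. of_bool b = c}"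
      unfolding dc B_def by (subst measure_distr) (auto intro!: arg_cong2[where f=measure])
    finally show ?thesis .
  qed
  have "{b. of_bool b = (1::real)} = {True}" "{b. of_bool b = (0::real)} = {False}" by auto
  then have "iid_bernoulli M \<alpha> (\<lambda>i \<omega>. \<omega> (Inl i)) (\<lambda>i \<omega>. \<omega> (Inr i))"
    unfolding iid_bernoulli_def using ind assms
    by (auto simp: pr M.prob_space_axioms measure_pmf_single)
  then show ?thesis by blast
qed

definition partial_sum :: "(nat \<Rightarrow> 'a \<Rightarrow> real) \<Rightarrow> nat \<Rightarrow> 'a \<Rightarrow> real" where
  "partial_sum X k \<omega> = (\<Sum>i=1..k. X i \<omega>)"

definition win_prob ::
  "'a measure \<Rightarrow> (nat \<Rightarrow> 'a \<Rightarrow> real) \<Rightarrow> (nat \<Rightarrow> 'a \<Rightarrow> real) \<Rightarrow> nat \<Rightarrow> nat \<Rightarrow> nat \<Rightarrow> real" where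
  "win_prob M X X' r d n =
     \<P>(\<omega> in M. partial_sum X (n + r) \<omega> \<ge> partial_sum X' n \<omega> + real d)"

text \<open>
  \<open>a\<^sub>0 < \<dots> < a\<^bsub>N-1\<^esub> \<le> a\<^sub>N > a\<^bsub>N+1\<^esub> > \<dots>\<close>; the step from \<open>N - 1\<close> to \<open>N\<close> is allowed to be an equality.
\<close>

definition unimodal_with_mode :: "(nat \<Rightarrow> real) \<Rightarrow> nat \<Rightarrow> bool" where
  "unimodal_with_mode a N \<longleftrightarrow>
     N \<ge> 1 \<and> strict_mono_on {..N - 1} a \<and> a (N - 1) \<le> a N \<and> strict_antimono_on {N..} a"

end

theory Submission
  imports Defs "HOL-Real_Asymp.Real_Asymp"
begin

text \<open>
  Write \<open>S\<^bsub>n+r\<^esub> - S'\<^sub>n = W\<^sub>n + J\<close> with \<open>W\<^sub>n\<close> a symmetric lazy walk (step \<open>\<plusminus>1\<close> with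
  probability \<open>s = \<alpha>(1-\<alpha>) \<le> 1/4\<close>) and \<open>J\<close> binomial with parameters \<open>r, \<alpha>\<close> and weights \<open>b\<^sub>j\<close>. With
  \<open>\<delta>\<^sub>n(j) = P(W\<^sub>n = j) - P(W\<^sub>n = j+1)\<close>, the increments of \<open>p\<^sub>n\<close> are
  \<open>s (b\<^sub>0 \<delta>\<^sub>n(0) - \<Sum>\<^bsub>j\<ge>1\<^esub> b\<^sub>j \<delta>\<^sub>n(j-1))\<close>. The \<open>\<delta>\<^sub>n\<close> evolve by a totally positive reflected kernel, so
  \<open>\<delta>\<^sub>n(j)/\<delta>\<^sub>n(0)\<close> increases in \<open>n\<close>, and it stays below \<open>2j+1\<close> because \<open>j \<mapsto> 2j+1\<close> is harmonic for the
  kernel. The former allows only one sign change of the increments, from \<open>+\<close> to \<open>-\<close>; the latter makes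
  them positive as soon as \<open>2r\<alpha> \<le> 1\<close>; and \<open>b\<^sub>1 > b\<^sub>0\<close>, i.e. \<open>\<alpha> > 1/(r+1)\<close>, makes them negative.

  The asymptotics come from the Fourier representation
  \<open>p\<^sub>n - 1/2 = 1/\<pi> \<integral>\<^sub>0\<^sup>\<pi> (1 - 2s(1 - cos \<theta>))\<^sup>n H(\<theta>) d\<theta>\<close> with \<open>H(\<theta>) \<approx> r\<epsilon> - c\<theta>\<^sup>2\<close> for
  \<open>\<epsilon> = \<alpha> - 1/(2r)\<close>, and dominated convergence after \<open>\<theta> = \<surd>\<epsilon> t\<close>, \<open>n \<sim> L/\<epsilon>\<close>: the increment changes sign
  at \<open>L = (r-1)/(4r)\<close>.
\<close>

section \<open>Reduction to a symmetric walk\<close>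

definition binom_mean :: "real \<Rightarrow> nat \<Rightarrow> (nat \<Rightarrow> real) \<Rightarrow> real" where
  "binom_mean \<alpha> r f = (\<Sum>j\<le>r. real (r choose j) * \<alpha> ^ j * (1 - \<alpha>) ^ (r - j) * f j)"

lemma binom_mean_0 [simp]: "binom_mean \<alpha> 0 f = f 0"
  by (simp add: binom_mean_def)

lemma binom_mean_Suc:
  "binom_mean \<alpha> (Suc r) f = \<alpha> * binom_mean \<alpha> r (\<lambda>j. f (Suc j)) + (1 - \<alpha>) * binom_mean \<alpha> r f"
proof -
  have 1: "(\<Sum>j\<le>r. real (r choose Suc j) * \<alpha> ^ Suc j * (1 - \<alpha>) ^ (r - j) * f (Suc j)) + (1 - \<alpha>) ^ Suc r * f 0
      = (1 - \<alpha>) * binom_mean \<alpha> r f"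
  proof -
    have "(\<Sum>j\<le>r. real (r choose Suc j) * \<alpha> ^ Suc j * (1 - \<alpha>) ^ (r - j) * f (Suc j)) + (1 - \<alpha>) ^ Suc r * f 0
      = (\<Sum>j\<le>Suc r. real (r choose j) * \<alpha> ^ j * (1 - \<alpha>) ^ (Suc r - j) * f j)"
      by (subst sum.atMost_Suc_shift) simp
    also have "\<dots> = (\<Sum>j\<le>r. real (r choose j) * \<alpha> ^ j * (1 - \<alpha>) ^ (Suc r - j) * f j)"
      by (simp add: binomial_eq_0)
    also have "\<dots> = (1 - \<alpha>) * binom_mean \<alpha> r f"
      unfolding binom_mean_def sum_distrib_left
      by (intro sum.cong refl) (simp add: Suc_diff_le)
    finally show ?thesis .
  qed
  have "binom_mean \<alpha> (Suc r) f = (1 - \<alpha>) ^ Suc r * f 0 +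
      (\<Sum>j\<le>r. real (Suc r choose Suc j) * \<alpha> ^ Suc j * (1 - \<alpha>) ^ (r - j) * f (Suc j))"
    unfolding binom_mean_def by (subst sum.atMost_Suc_shift) simp
  also have "(\<Sum>j\<le>r. real (Suc r choose Suc j) * \<alpha> ^ Suc j * (1 - \<alpha>) ^ (r - j) * f (Suc j))
     = (\<Sum>j\<le>r. real (r choose Suc j) * \<alpha> ^ Suc j * (1 - \<alpha>) ^ (r - j) * f (Suc j))
       + \<alpha> * binom_mean \<alpha> r (\<lambda>j. f (Suc j))"
    unfolding binom_mean_def sum_distrib_left sum.distrib[symmetric]
    by (intro sum.cong refl) (simp add: algebra_simps)
  finally show ?thesis using 1 by simp
qed

lemma binom_mean_add: "binom_mean \<alpha> r (\<lambda>j. f j + g j) = binom_mean \<alpha> r f + binom_mean \<alpha> r g"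
  by (simp add: binom_mean_def sum.distrib distrib_left)

lemma binom_mean_diff: "binom_mean \<alpha> r (\<lambda>j. f j - g j) = binom_mean \<alpha> r f - binom_mean \<alpha> r g"
  by (simp add: binom_mean_def sum_subtractf right_diff_distrib)

lemma binom_mean_cmult: "binom_mean \<alpha> r (\<lambda>j. c * f j) = c * binom_mean \<alpha> r f"
  by (simp add: binom_mean_def sum_distrib_left mult_ac)

lemma binom_mean_const: "binom_mean \<alpha> r (\<lambda>j. c) = c"
  by (induction r) (simp_all add: binom_mean_Suc algebra_simps)

lemma binom_mean_id: "binom_mean \<alpha> r real = r * \<alpha>"
  by (induction r)
    (simp_all add: binom_mean_Suc binom_mean_add binom_mean_const algebra_simps)

lemma binom_mean_mono:
  assumes "0 \<le> \<alpha>" "\<alpha> \<le> 1" "\<And>j. j \<le> r \<Longrightarrow> f j \<le> g j"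
  shows "binom_mean \<alpha> r f \<le> binom_mean \<alpha> r g"
  unfolding binom_mean_def by (intro sum_mono mult_left_mono) (use assms in auto)

lemma binom_mean_strict_mono:
  assumes "0 < \<alpha>" "\<alpha> < 1" "\<And>j. j \<le> r \<Longrightarrow> f j \<le> g j" "k \<le> r" "f k < g k"
  shows "binom_mean \<alpha> r f < binom_mean \<alpha> r g"
  unfolding binom_mean_def
proof (rule sum_strict_mono_ex1)
  show "\<forall>x\<in>{..r}. real (r choose x) * \<alpha> ^ x * (1 - \<alpha>) ^ (r - x) * f x
      \<le> real (r choose x) * \<alpha> ^ x * (1 - \<alpha>) ^ (r - x) * g x"
    using assms by (auto intro!: mult_left_mono)
  have "0 < real (r choose k) * \<alpha> ^ k * (1 - \<alpha>) ^ (r - k)"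
    using assms by simp
  then show "\<exists>a\<in>{..r}. real (r choose a) * \<alpha> ^ a * (1 - \<alpha>) ^ (r - a) * f a
      < real (r choose a) * \<alpha> ^ a * (1 - \<alpha>) ^ (r - a) * g a"
    using assms by (intro bexI[of _ k]) (auto intro!: mult_strict_left_mono)
qed simp

fun walk_tail :: "real \<Rightarrow> nat \<Rightarrow> int \<Rightarrow> real" where
  "walk_tail s 0 d = (if d \<le> 0 then 1 else 0)"
| "walk_tail s (Suc n) d =
     s * walk_tail s n (d - 1) + (1 - 2 * s) * walk_tail s n d + s * walk_tail s n (d + 1)"

lemma (in prob_space) prob_add_two_point:
  fixes Y T :: "'a \<Rightarrow> real"
  assumes ind: "indep_var borel Y borel T"
    and a: "prob {\<omega> \<in> space M. Y \<omega> = a} = \<beta>"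
    and b: "prob {\<omega> \<in> space M. Y \<omega> = b} = 1 - \<beta>" and ne: "a \<noteq> b"
  shows "prob {\<omega> \<in> space M. c \<le> Y \<omega> + T \<omega>} =
    \<beta> * prob {\<omega> \<in> space M. c - a \<le> T \<omega>} + (1 - \<beta>) * prob {\<omega> \<in> space M. c - b \<le> T \<omega>}"
proof -
  have [measurable]: "Y \<in> borel_measurable M" "T \<in> borel_measurable M"
    using indep_var_rv1[OF ind] indep_var_rv2[OF ind] by auto
  have split: "prob {\<omega> \<in> space M. Y \<omega> = v \<and> c - v \<le> T \<omega>}
      = prob {\<omega> \<in> space M. Y \<omega> = v} * prob {\<omega> \<in> space M. c - v \<le> T \<omega>}" for v
    using indep_varD[OF ind, of "{v}" "{c - v..}"]
    by (simp add: vimage_def Int_def conj_commute conj_left_commute cong: conj_cong)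
  have "prob {\<omega> \<in> space M. Y \<omega> = a \<or> Y \<omega> = b}
      = prob {\<omega> \<in> space M. Y \<omega> = a} + prob {\<omega> \<in> space M. Y \<omega> = b}"
    using ne by (subst finite_measure_Union[symmetric]) (auto intro!: arg_cong[where f=prob])
  then have "prob {\<omega> \<in> space M. Y \<omega> = a \<or> Y \<omega> = b} = 1"
    by (simp add: a b)
  then have ae: "AE \<omega> in M. Y \<omega> = a \<or> Y \<omega> = b"
    by (subst prob_Collect_eq_1[symmetric]) auto
  have "prob {\<omega> \<in> space M. c \<le> Y \<omega> + T \<omega>}
      = prob ({\<omega> \<in> space M. Y \<omega> = a \<and> c - a \<le> T \<omega>} \<union> {\<omega> \<in> space M. Y \<omega> = b \<and> c - b \<le> T \<omega>})"
    by (rule finite_measure_eq_AE) (use ae in \<open>auto simp: field_simps\<close>)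
  also have "\<dots> = prob {\<omega> \<in> space M. Y \<omega> = a \<and> c - a \<le> T \<omega>}
      + prob {\<omega> \<in> space M. Y \<omega> = b \<and> c - b \<le> T \<omega>}"
    using ne by (intro finite_measure_Union) auto
  finally show ?thesis
    unfolding split a b .
qed

lemma win_prob_eq_binom_mean:
  assumes "iid_bernoulli M \<alpha> X X'"
  shows "win_prob M X X' r d n =
    binom_mean \<alpha> r (\<lambda>j. walk_tail (\<alpha> * (1 - \<alpha>)) n (int d - int j))"
proof -
  interpret prob_space M using assms by (simp add: iid_bernoulli_def)
  define Y where "Y = case_sum X (\<lambda>i \<omega>. - X' i \<omega>)"
  define I where "I = ({1..} <+> {1..} :: (nat + nat) set)"
  define D where "D a b \<omega> = (\<Sum>i\<in>{1..a} <+> {1..b}. Y i \<omega>)" for a b \<omega>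
  define F where "F a b (d::int) = prob {\<omega> \<in> space M. of_int d \<le> D a b \<omega>}" for a b d
  have "indep_vars (\<lambda>_. borel) (case_sum X X') I"
    using assms by (simp add: iid_bernoulli_def I_def)
  then have "indep_vars (\<lambda>_. borel) (\<lambda>i \<omega>. (case i of Inl _ \<Rightarrow> (\<lambda>x. x) | Inr _ \<Rightarrow> uminus) (case_sum X X' i \<omega>)) I"
    by (rule indep_vars_compose2) (auto split: sum.splits)
  moreover have "(\<lambda>i \<omega>. (case i of Inl _ \<Rightarrow> (\<lambda>x. x) | Inr _ \<Rightarrow> uminus) (case_sum X X' i \<omega>)) = Y"
    by (auto simp: Y_def fun_eq_iff split: sum.splits)
  ultimately have indY: "indep_vars (\<lambda>_. borel) Y I" by simp
  have D_eq: "D a b \<omega> = partial_sum X a \<omega> - partial_sum X' b \<omega>" for a b \<omega>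
    unfolding D_def partial_sum_def
    by (subst sum.Plus) (simp_all add: Y_def sum_negf)
  have ind: "indep_var borel (Y i) borel (D a b)" if "i \<in> I" "i \<notin> {1..a} <+> {1..b}" for i a b
  proof -
    have "indep_vars (\<lambda>_. borel) Y (insert i ({1..a} <+> {1..b}))"
      using that by (intro indep_vars_subset[OF indY]) (auto simp: I_def)
    from indep_vars_sum[OF _ that(2) this] show ?thesis
      unfolding D_def[abs_def] by simp
  qed
  have FX: "F (Suc a) b d = \<alpha> * F a b (d - 1) + (1 - \<alpha>) * F a b d" for a b d
  proof -
    have "D (Suc a) b \<omega> = Y (Inl (Suc a)) \<omega> + D a b \<omega>" for \<omega>
      by (simp add: D_eq Y_def partial_sum_def)
    then have "F (Suc a) b d = prob {\<omega> \<in> space M. of_int d \<le> Y (Inl (Suc a)) \<omega> + D a b \<omega>}"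
      by (simp add: F_def)
    also have "\<dots> = \<alpha> * prob {\<omega> \<in> space M. of_int d - 1 \<le> D a b \<omega>} + (1 - \<alpha>) * prob {\<omega> \<in> space M. of_int d - 0 \<le> D a b \<omega>}"
      by (rule prob_add_two_point[OF ind])
        (use assms in \<open>auto simp: I_def Y_def iid_bernoulli_def\<close>)
    finally show ?thesis by (simp add: F_def)
  qed
  have FX': "F a (Suc b) d = \<alpha> * F a b (d + 1) + (1 - \<alpha>) * F a b d" for a b d
  proof -
    have "D a (Suc b) \<omega> = Y (Inr (Suc b)) \<omega> + D a b \<omega>" for \<omega>
      by (simp add: D_eq Y_def partial_sum_def)
    then have "F a (Suc b) d = prob {\<omega> \<in> space M. of_int d \<le> Y (Inr (Suc b)) \<omega> + D a b \<omega>}"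
      by (simp add: F_def)
    also have "\<dots> = \<alpha> * prob {\<omega> \<in> space M. of_int d - (-1) \<le> D a b \<omega>} + (1 - \<alpha>) * prob {\<omega> \<in> space M. of_int d - 0 \<le> D a b \<omega>}"
    proof (rule prob_add_two_point[OF ind])
      have "- X' (Suc b) \<omega> = - 1 \<longleftrightarrow> X' (Suc b) \<omega> = 1" for \<omega> by linarith
      then show "prob {\<omega> \<in> space M. Y (Inr (Suc b)) \<omega> = - 1} = \<alpha>"
        using assms by (simp add: Y_def iid_bernoulli_def)
    qed (use assms in \<open>auto simp: I_def Y_def iid_bernoulli_def\<close>)
    finally show ?thesis by (simp add: F_def)
  qed
  have F0: "F n n d = walk_tail (\<alpha> * (1 - \<alpha>)) n d" for n d
  proof (induction n arbitrary: d)
    case 0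
    have "D 0 0 \<omega> = 0" for \<omega> by (simp add: D_eq partial_sum_def)
    then show ?case by (auto simp: F_def prob_space)
  next
    case (Suc n)
    then show ?case by (simp add: FX FX' algebra_simps)
  qed
  have "F (n + r) n d = binom_mean \<alpha> r (\<lambda>j. walk_tail (\<alpha> * (1 - \<alpha>)) n (d - int j))" for d
  proof (induction r arbitrary: d)
    case (Suc r)
    have "d - int (Suc j) = d - 1 - int j" for j by simp
    then show ?case by (simp only: add_Suc_right FX Suc binom_mean_Suc)
  qed (simp add: F0)
  moreover have "win_prob M X X' r d n = F (n + r) n (int d)"
    by (simp add: win_prob_def F_def D_eq algebra_simps)
  ultimately show ?thesis by simp
qed

definition walk_prob :: "real \<Rightarrow> nat \<Rightarrow> int \<Rightarrow> real" where
  "walk_prob s n j = walk_tail s n j - walk_tail s n (j + 1)"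

definition walk_drop :: "real \<Rightarrow> nat \<Rightarrow> nat \<Rightarrow> real" where
  "walk_drop s n j = walk_prob s n (int j) - walk_prob s n (int j + 1)"

lemma walk_tail_reflect: "walk_tail s n (1 - d) = 1 - walk_tail s n d"
proof (induction n arbitrary: d)
  case (Suc n)
  have refl: "walk_tail s n (2 - d) = 1 - walk_tail s n (d - 1)"
       "walk_tail s n (- d) = 1 - walk_tail s n (d + 1)"
    using Suc[of "d - 1"] Suc[of "d + 1"] by simp_all
  show ?case by (simp add: Suc[of d] refl) (simp add: algebra_simps)
qed simp

lemma walk_prob_minus: "walk_prob s n (- j) = walk_prob s n j"
  using walk_tail_reflect[of s n "1 + j"] walk_tail_reflect[of s n j]
  by (simp add: walk_prob_def algebra_simps)

lemma walk_prob_Suc: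
  "walk_prob s (Suc n) j =
     s * walk_prob s n (j - 1) + (1 - 2 * s) * walk_prob s n j + s * walk_prob s n (j + 1)"
  by (simp add: walk_prob_def algebra_simps)

lemma walk_tail_eq_sum:
  "walk_tail s n (1 - int j) = 1 / 2 + ((\<Sum>i<j. walk_prob s n (int i)) - walk_prob s n 0 / 2)"
proof (induction j)
  case 0
  show ?case using walk_tail_reflect[of s n 0] by (simp add: walk_prob_def field_simps)
next
  case (Suc j)
  have "walk_tail s n (1 - int (Suc j)) = walk_tail s n (1 - int j) + walk_prob s n (- int j)"
    by (simp add: walk_prob_def)
  then show ?case by (simp add: Suc walk_prob_minus)
qed

lemma walk_tail_Suc_diff:
  "walk_tail s (Suc n) (1 - int j) - walk_tail s n (1 - int j) =
     s * (case j of 0 \<Rightarrow> walk_drop s n 0 | Suc i \<Rightarrow> - walk_drop s n i)"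
proof -
  have "walk_tail s (Suc n) (1 - int j) - walk_tail s n (1 - int j)
      = s * (walk_prob s n (- int j) - walk_prob s n (1 - int j))"
    by (simp add: walk_prob_def algebra_simps)
  moreover have "walk_prob s n (- 1 - int i) = walk_prob s n (int i + 1)" for i
    using walk_prob_minus[of s n "int i + 1"] by (simp add: algebra_simps)
  ultimately show ?thesis
    by (cases j) (simp_all add: walk_drop_def walk_prob_minus)
qed

section \<open>Likelihood ratio ordering of the increments\<close>

definition refl_step :: "real \<Rightarrow> (nat \<Rightarrow> real) \<Rightarrow> nat \<Rightarrow> real" where
  "refl_step s f j = (case j of
      0 \<Rightarrow> (1 - 3 * s) * f 0 + s * f 1
    | Suc i \<Rightarrow> s * f i + (1 - 2 * s) * f (Suc i) + s * f (Suc (Suc i)))"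

lemma walk_drop_0: "walk_drop s 0 j = (if j = 0 then 1 else 0)"
  by (auto simp: walk_drop_def walk_prob_def)

lemma walk_drop_Suc: "walk_drop s (Suc n) = refl_step s (walk_drop s n)"
proof
  fix j
  show "walk_drop s (Suc n) j = refl_step s (walk_drop s n) j"
    using walk_prob_minus[of s n 1]
    by (cases j) (simp_all add: walk_drop_def refl_step_def walk_prob_Suc algebra_simps)
qed

lemma walk_drop_nonneg:
  assumes "0 \<le> s" "s \<le> 1 / 4"
  shows "0 \<le> walk_drop s n j"
  using assms
  by (induction n arbitrary: j)
    (auto simp: walk_drop_0 walk_drop_Suc refl_step_def split: nat.split intro!: add_nonneg_nonneg)

lemma walk_drop_0_pos:
  assumes "0 \<le> s" "s \<le> 1 / 4"
  shows "0 < walk_drop s n 0"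
proof (induction n)
  case (Suc n)
  then show ?case using assms walk_drop_nonneg[OF assms, of n 1]
    by (auto simp: walk_drop_Suc refl_step_def intro!: add_pos_nonneg)
qed (simp add: walk_drop_0)

text \<open>Denominators are cleared since \<open>f\<close> may vanish, as the differences \<open>\<delta>\<^sub>n(j)\<close> do for \<open>j > n\<close>.\<close>

definition lr_le :: "(nat \<Rightarrow> real) \<Rightarrow> (nat \<Rightarrow> real) \<Rightarrow> bool" where
  "lr_le f g \<longleftrightarrow> (\<forall>i j. i < j \<longrightarrow> f j * g i \<le> f i * g j) \<and> f 1 * g 0 < f 0 * g 1"

lemma lr_le_refl_step:
  assumes s: "0 < s" "s \<le> 1 / 4" and le: "lr_le f g"
  shows "lr_le (refl_step s f) (refl_step s g)"
proof -
  define W where "W i j = f i * g j - f j * g i" for i j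
  have W: "0 \<le> W i j" if "i \<le> j" for i j
    using le that by (cases "i = j") (auto simp: lr_le_def W_def mult.commute)
  have W01: "0 < W 0 1" using le by (auto simp: lr_le_def W_def mult.commute)
  define V where "V i j = refl_step s f i * refl_step s g j - refl_step s f j * refl_step s g i" for i j
  have c: "0 < (1 - 3 * s) * (1 - 2 * s) - s\<^sup>2" "0 \<le> (1 - 2 * s) * (1 - 2 * s) - s\<^sup>2"
  proof -
    have "1 / 4 * (1 / 2) \<le> (1 - 3 * s) * (1 - 2 * s)"
         "1 / 2 * (1 / 2) \<le> (1 - 2 * s) * (1 - 2 * s)" "s * s \<le> 1 / 4 * (1 / 4)"
      using s by (intro mult_mono; simp)+
    then show "0 < (1 - 3 * s) * (1 - 2 * s) - s\<^sup>2" "0 \<le> (1 - 2 * s) * (1 - 2 * s) - s\<^sup>2"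
      by (simp_all add: power2_eq_square)
  qed
  have V01: "0 < V 0 1"
  proof -
    have "V 0 1 = ((1 - 3 * s) * (1 - 2 * s) - s\<^sup>2) * W 0 1 + (1 - 3 * s) * s * W 0 2 + s * s * W 1 2"
      by (simp add: V_def W_def refl_step_def numeral_2_eq_2 power2_eq_square algebra_simps)
    then show ?thesis
      using s c W01 W[of 0 2] W[of 1 2] by (auto intro!: add_pos_nonneg mult_nonneg_nonneg)
  qed
  have "0 \<le> V i j" if ij: "i < j" for i j
  proof (cases i)
    case i: 0
    show ?thesis
    proof (cases "j = 1")
      case True
      then show ?thesis using V01 i by simp
    next
      case False
      with i ij obtain k where j: "j = Suc (Suc k)"
        by (metis One_nat_def less_imp_Suc_add add_0 not0_implies_Suc)
      have "V i j = (1 - 3 * s) * (s * W 0 (Suc k) + (1 - 2 * s) * W 0 j + s * W 0 (Suc j))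
          + s * (s * W 1 (Suc k) + (1 - 2 * s) * W 1 j + s * W 1 (Suc j))"
        by (simp add: V_def W_def i j refl_step_def algebra_simps)
      then show ?thesis using s by (auto simp: j intro!: add_nonneg_nonneg mult_nonneg_nonneg W)
    qed
  next
    case i: (Suc l)
    show ?thesis
    proof (cases "j = Suc i")
      case True
      have "V i j = s * s * W l i + s * (1 - 2 * s) * W l j + s * s * W l (Suc j)
          + ((1 - 2 * s) * (1 - 2 * s) - s\<^sup>2) * W i j
          + (1 - 2 * s) * s * W i (Suc j) + s * s * W j (Suc j)"
        by (simp add: V_def W_def i True refl_step_def power2_eq_square algebra_simps)
      then show ?thesis using s c
        by (auto simp: i True intro!: add_nonneg_nonneg mult_nonneg_nonneg W)
    next
      case False
      with i ij obtain k where j: "j = Suc k" "i < k"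
        by (metis Suc_lessE Suc_lessI less_Suc_eq)
      have "V i j = s * (s * W l k + (1 - 2 * s) * W l j + s * W l (Suc j))
          + (1 - 2 * s) * (s * W i k + (1 - 2 * s) * W i j + s * W i (Suc j))
          + s * (s * W (Suc i) k + (1 - 2 * s) * W (Suc i) j + s * W (Suc i) (Suc j))"
        by (simp add: V_def W_def i j refl_step_def algebra_simps)
      then show ?thesis using s i j
        by (auto intro!: add_nonneg_nonneg mult_nonneg_nonneg W)
    qed
  qed
  with V01 show ?thesis by (auto simp: lr_le_def V_def)
qed

lemma walk_drop_lr_le_Suc:
  assumes "0 < s" "s \<le> 1 / 4"
  shows "lr_le (walk_drop s n) (walk_drop s (Suc n))"
proof (induction n)
  case 0
  then show ?case using assms
    by (auto simp: lr_le_def walk_drop_0 walk_drop_Suc refl_step_def split: nat.split)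
next
  case (Suc n)
  then show ?case using lr_le_refl_step[OF assms] by (simp add: walk_drop_Suc)
qed

lemma walk_drop_lr_le_odd:
  assumes "0 < s" "s \<le> 1 / 4"
  shows "lr_le (walk_drop s n) (\<lambda>j. 2 * real j + 1)"
proof (induction n)
  case 0
  then show ?case by (auto simp: lr_le_def walk_drop_0)
next
  case (Suc n)
  have "refl_step s (\<lambda>j. 2 * real j + 1) = (\<lambda>j. 2 * real j + 1)"
    by (auto simp: refl_step_def fun_eq_iff algebra_simps split: nat.split)
  then show ?case using lr_le_refl_step[OF assms Suc] by (simp add: walk_drop_Suc)
qed

definition race :: "real \<Rightarrow> nat \<Rightarrow> nat \<Rightarrow> real" where
  "race \<alpha> r n = binom_mean \<alpha> r (\<lambda>j. walk_tail (\<alpha> * (1 - \<alpha>)) n (1 - int j))"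

definition race_incr :: "real \<Rightarrow> nat \<Rightarrow> nat \<Rightarrow> real" where
  "race_incr \<alpha> r n = binom_mean \<alpha> r
     (\<lambda>j. case j of 0 \<Rightarrow> walk_drop (\<alpha> * (1 - \<alpha>)) n 0 | Suc i \<Rightarrow> - walk_drop (\<alpha> * (1 - \<alpha>)) n i)"

lemma race_Suc_diff: "race \<alpha> r (Suc n) - race \<alpha> r n = \<alpha> * (1 - \<alpha>) * race_incr \<alpha> r n"
  unfolding race_def race_incr_def binom_mean_diff[symmetric] walk_tail_Suc_diff
  by (rule binom_mean_cmult)

lemma variance_bounds:
  fixes \<alpha> :: real
  assumes "0 < \<alpha>" "\<alpha> < 1"
  shows "0 < \<alpha> * (1 - \<alpha>)" "\<alpha> * (1 - \<alpha>) \<le> 1 / 4"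
proof -
  show "0 < \<alpha> * (1 - \<alpha>)" using assms by simp
  have "0 \<le> (\<alpha> - 1 / 2)\<^sup>2" by simp
  then show "\<alpha> * (1 - \<alpha>) \<le> 1 / 4" by (simp add: power2_eq_square algebra_simps)
qed

lemma race_incr_pos:
  assumes "r \<ge> 2" "0 < \<alpha>" "\<alpha> \<le> 1 / (2 * real r)"
  shows "0 < race_incr \<alpha> r n"
proof -
  have "1 / (2 * real r) < 1" using assms(1) by simp
  with assms(3) have a1: "\<alpha> < 1" by (rule le_less_trans)
  define D where "D = walk_drop (\<alpha> * (1 - \<alpha>)) n"
  have lr: "lr_le D (\<lambda>j. 2 * real j + 1)"
    unfolding D_def by (intro walk_drop_lr_le_odd variance_bounds assms a1)
  have le: "D i \<le> D 0 * (2 * real i + 1)" for i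
    using lr by (cases "i = 0") (auto simp: lr_le_def dest: spec[of _ 0])
  have lt: "D 1 < D 0 * 3" using lr by (simp add: lr_le_def)
  have "0 \<le> D 0 * (1 - 2 * (real r * \<alpha>))"
    using assms walk_drop_nonneg[of "\<alpha> * (1 - \<alpha>)" n 0] variance_bounds[OF assms(2) a1]
    by (intro mult_nonneg_nonneg) (auto simp: D_def field_simps)
  also have "\<dots> = binom_mean \<alpha> r (\<lambda>j. D 0 * (1 - 2 * real j))"
    by (simp add: binom_mean_cmult binom_mean_diff binom_mean_const binom_mean_id)
  also have "\<dots> < binom_mean \<alpha> r (\<lambda>j. case j of 0 \<Rightarrow> D 0 | Suc i \<Rightarrow> - D i)"
  proof (rule binom_mean_strict_mono[where k = 2])
    show "D 0 * (1 - 2 * real j) \<le> (case j of 0 \<Rightarrow> D 0 | Suc i \<Rightarrow> - D i)" for j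
      using le by (auto simp: algebra_simps split: nat.split)
  qed (use assms a1 lt in \<open>auto simp: numeral_2_eq_2\<close>)
  finally show ?thesis unfolding race_incr_def D_def[symmetric] .
qed

lemma race_incr_neg:
  assumes "r \<ge> 1" "1 / (real r + 1) < \<alpha>" "\<alpha> < 1"
  shows "race_incr \<alpha> r n < 0"
proof -
  have a0: "0 < \<alpha>"
    using assms(2) by (rule le_less_trans[rotated]) simp
  define D where "D = walk_drop (\<alpha> * (1 - \<alpha>)) n"
  note vb = variance_bounds[OF a0 assms(3)]
  have D: "0 \<le> D i" "0 < D 0" for i
    using vb by (auto simp: D_def intro!: walk_drop_nonneg walk_drop_0_pos)
  have "race_incr \<alpha> r n \<le> binom_mean \<alpha> r (\<lambda>j. D 0 * (if j = 0 then 1 else if j = 1 then -1 else 0))"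
    unfolding race_incr_def D_def[symmetric] using a0 assms D
    by (intro binom_mean_mono) (auto split: nat.split)
  also have "\<dots> = D 0 * (1 - \<alpha>) ^ (r - 1) * ((1 - \<alpha>) - real r * \<alpha>)"
  proof -
    obtain k where r: "r = Suc k" using assms(1) by (cases r) auto
    have "binom_mean \<alpha> r (\<lambda>j. D 0 * (if j = 0 then 1 else if j = 1 then -1 else 0))
      = (\<Sum>j\<in>{0, 1}. real (r choose j) * \<alpha> ^ j * (1 - \<alpha>) ^ (r - j) * (D 0 * (if j = 0 then 1 else if j = 1 then -1 else 0)))"
      unfolding binom_mean_def by (rule sum.mono_neutral_right) (use assms(1) in auto)
    then show ?thesis by (simp add: r algebra_simps)
  qed
  also have "\<dots> < 0"
    using D(2) assms by (intro mult_pos_neg) (auto simp: field_simps)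
  finally show ?thesis .
qed

lemma race_incr_0:
  assumes "r \<ge> 1"
  shows "race_incr \<alpha> r 0 = (1 - \<alpha>) ^ (r - 1) * (1 - (real r + 1) * \<alpha>)"
proof -
  obtain k where r: "r = Suc k" using assms(1) by (cases r) auto
  have "race_incr \<alpha> r 0
    = (\<Sum>j\<in>{0, 1}. real (r choose j) * \<alpha> ^ j * (1 - \<alpha>) ^ (r - j) * (if j = 0 then 1 else -1))"
    unfolding race_incr_def binom_mean_def
    by (rule sum.mono_neutral_cong_right) (use assms(1) in \<open>auto simp: walk_drop_0 split: nat.splits\<close>)
  then show ?thesis by (simp add: r algebra_simps)
qed

lemma race_incr_neg_Suc:
  assumes "r \<ge> 2" "0 < \<alpha>" "\<alpha> < 1" "race_incr \<alpha> r n \<le> 0"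
  shows "race_incr \<alpha> r (Suc n) < 0"
proof -
  note vb = variance_bounds[OF assms(2,3)]
  define D where "D = walk_drop (\<alpha> * (1 - \<alpha>)) n"
  define E where "E = walk_drop (\<alpha> * (1 - \<alpha>)) (Suc n)"
  have pos: "0 < D 0" "0 < E 0"
    unfolding D_def E_def using vb by (auto intro!: walk_drop_0_pos)
  have lr: "lr_le D E" unfolding D_def E_def by (rule walk_drop_lr_le_Suc[OF vb])
  have "D 0 * race_incr \<alpha> r (Suc n) = binom_mean \<alpha> r (\<lambda>j. D 0 * (case j of 0 \<Rightarrow> E 0 | Suc i \<Rightarrow> - E i))"
    unfolding race_incr_def E_def[symmetric] by (simp add: binom_mean_cmult)
  also have "\<dots> < binom_mean \<alpha> r (\<lambda>j. E 0 * (case j of 0 \<Rightarrow> D 0 | Suc i \<Rightarrow> - D i))"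
  proof (rule binom_mean_strict_mono[where k = 2])
    show "D 0 * (case j of 0 \<Rightarrow> E 0 | Suc i \<Rightarrow> - E i) \<le> E 0 * (case j of 0 \<Rightarrow> D 0 | Suc i \<Rightarrow> - D i)" for j
      using lr by (cases "j - 1 = 0") (auto simp: lr_le_def mult.commute split: nat.split)
  qed (use assms lr in \<open>auto simp: lr_le_def numeral_2_eq_2 mult.commute\<close>)
  also have "\<dots> = E 0 * race_incr \<alpha> r n"
    unfolding race_incr_def D_def[symmetric] by (simp add: binom_mean_cmult)
  also have "\<dots> \<le> 0" using pos assms(4) by (simp add: mult_nonneg_nonpos)
  finally show ?thesis using pos by (simp add: mult_less_0_iff)
qed

section \<open>Fourier representation\<close>

lemma has_integral_binom_mean:
  assumes "\<And>j. (f j has_integral c j) S"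
  shows "((\<lambda>x. binom_mean \<alpha> r (\<lambda>j. f j x)) has_integral binom_mean \<alpha> r c) S"
  unfolding binom_mean_def by (intro has_integral_sum has_integral_mult_right assms) simp

definition walk_cf :: "real \<Rightarrow> real \<Rightarrow> real" where
  "walk_cf s \<theta> = 1 - 2 * s * (1 - cos \<theta>)"

lemma continuous_on_walk_cf [continuous_intros]:
  fixes S :: "real set"
  shows "continuous_on S f \<Longrightarrow> continuous_on S (\<lambda>x. walk_cf s (f x))"
  unfolding walk_cf_def by (intro continuous_intros)

lemma has_integral_walk_prob:
  "((\<lambda>\<theta>. cos (of_int j * \<theta>) * walk_cf s \<theta> ^ n) has_integral pi * walk_prob s n j) {0..pi}"
proof (induction n arbitrary: j)
  case 0
  show ?case
  proof (cases "j = 0")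
    case True
    then show ?thesis using has_integral_const_real[of "1::real" 0 pi] by (simp add: walk_prob_def)
  next
    case False
    have "((\<lambda>\<theta>. cos (of_int j * \<theta>)) has_integral
        sin (of_int j * pi) / of_int j - sin (of_int j * 0) / of_int j) {0..pi}"
      by (rule fundamental_theorem_of_calculus)
        (use False in \<open>auto intro!: derivative_eq_intros simp: has_real_derivative_iff_has_vector_derivative[symmetric]\<close>)
    then show ?thesis using False sin_npi_int[of j] by (auto simp: walk_prob_def mult.commute)
  qed
next
  case (Suc n)
  have "((\<lambda>\<theta>. s * (cos (of_int (j - 1) * \<theta>) * walk_cf s \<theta> ^ n)
      + (1 - 2 * s) * (cos (of_int j * \<theta>) * walk_cf s \<theta> ^ n)
      + s * (cos (of_int (j + 1) * \<theta>) * walk_cf s \<theta> ^ n)) has_integral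
      s * (pi * walk_prob s n (j - 1)) + (1 - 2 * s) * (pi * walk_prob s n j)
      + s * (pi * walk_prob s n (j + 1))) {0..pi}"
    by (intro has_integral_add has_integral_mult_right Suc)
  moreover have "s * (cos (of_int (j - 1) * \<theta>) * walk_cf s \<theta> ^ n)
      + (1 - 2 * s) * (cos (of_int j * \<theta>) * walk_cf s \<theta> ^ n)
      + s * (cos (of_int (j + 1) * \<theta>) * walk_cf s \<theta> ^ n)
      = cos (of_int j * \<theta>) * walk_cf s \<theta> ^ Suc n" for \<theta>
  proof -
    have lin: "s * (p * w) + (1 - 2 * s) * (q * w) + s * (p' * w) = (q * (1 - 2 * s) + s * (p + p')) * w"
      for p q p' w :: real
      by (simp add: algebra_simps)
    have sum: "cos (of_int (j - 1) * \<theta>) + cos (of_int (j + 1) * \<theta>) = 2 * (cos (of_int j * \<theta>) * cos \<theta>)"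
      by (simp add: left_diff_distrib distrib_right cos_diff cos_add)
    have "walk_cf s \<theta> ^ Suc n = (1 - 2 * s * (1 - cos \<theta>)) * walk_cf s \<theta> ^ n"
      by (simp add: walk_cf_def)
    then show ?thesis
      unfolding lin sum by (simp only:) (simp add: algebra_simps)
  qed
  ultimately show ?case by (simp add: walk_prob_Suc algebra_simps)
qed

definition race_kernel :: "real \<Rightarrow> nat \<Rightarrow> real \<Rightarrow> real" where
  "race_kernel \<alpha> r \<theta> = binom_mean \<alpha> r (\<lambda>j. (\<Sum>i<j. cos (real i * \<theta>)) - 1 / 2)"

lemma continuous_on_race_kernel [continuous_intros]:
  fixes S :: "real set"
  shows "continuous_on S f \<Longrightarrow> continuous_on S (\<lambda>x. race_kernel \<alpha> r (f x))"
  unfolding race_kernel_def binom_mean_def by (intro continuous_intros)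

lemma has_integral_race:
  "((\<lambda>\<theta>. walk_cf (\<alpha> * (1 - \<alpha>)) \<theta> ^ n * race_kernel \<alpha> r \<theta>) has_integral
     pi * (race \<alpha> r n - 1 / 2)) {0..pi}"
proof -
  define s where "s = \<alpha> * (1 - \<alpha>)"
  have "((\<lambda>\<theta>. binom_mean \<alpha> r (\<lambda>j. (\<Sum>i<j. cos (of_int (int i) * \<theta>) * walk_cf s \<theta> ^ n)
        - 1 / 2 * (cos (of_int 0 * \<theta>) * walk_cf s \<theta> ^ n))) has_integral
      binom_mean \<alpha> r (\<lambda>j. (\<Sum>i<j. pi * walk_prob s n (int i)) - 1 / 2 * (pi * walk_prob s n 0))) {0..pi}"
    by (intro has_integral_binom_mean has_integral_diff has_integral_sum has_integral_mult_right
        has_integral_walk_prob) simp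
  also have "binom_mean \<alpha> r (\<lambda>j. (\<Sum>i<j. pi * walk_prob s n (int i)) - 1 / 2 * (pi * walk_prob s n 0))
      = pi * (race \<alpha> r n - 1 / 2)"
  proof -
    have "race \<alpha> r n - 1 / 2 = binom_mean \<alpha> r (\<lambda>j. (\<Sum>i<j. walk_prob s n (int i)) - walk_prob s n 0 / 2)"
      unfolding race_def walk_tail_eq_sum s_def[symmetric] by (subst binom_mean_add) (simp add: binom_mean_const)
    then show ?thesis
      by (simp add: binom_mean_cmult[symmetric] sum_distrib_left right_diff_distrib)
  qed
  also have "(\<lambda>\<theta>. binom_mean \<alpha> r (\<lambda>j. (\<Sum>i<j. cos (of_int (int i) * \<theta>) * walk_cf s \<theta> ^ n)
        - 1 / 2 * (cos (of_int 0 * \<theta>) * walk_cf s \<theta> ^ n)))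
      = (\<lambda>\<theta>. walk_cf s \<theta> ^ n * race_kernel \<alpha> r \<theta>)"
    by (simp add: fun_eq_iff race_kernel_def binom_mean_cmult[symmetric] sum_distrib_left
        right_diff_distrib mult_ac)
  finally show ?thesis by (simp add: s_def)
qed

lemma has_integral_race_diff:
  "((\<lambda>\<theta>. walk_cf (\<alpha> * (1 - \<alpha>)) \<theta> ^ n * ((1 - walk_cf (\<alpha> * (1 - \<alpha>)) \<theta>) * race_kernel \<alpha> r \<theta>)) has_integral
     pi * (race \<alpha> r n - race \<alpha> r (Suc n))) {0..pi}"
  using has_integral_diff[OF has_integral_race[of \<alpha> n r] has_integral_race[of \<alpha> "Suc n" r]]
  by (simp add: algebra_simps)

section \<open>Laplace asymptotics\<close>

lemma one_minus_cos_le: "1 - cos x \<le> x\<^sup>2 / 2" for x :: real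
proof -
  have "(sin (x / 2))\<^sup>2 \<le> (x / 2)\<^sup>2"
    using abs_sin_x_le_abs_x[of "x / 2"] abs_le_square_iff by blast
  moreover have "cos x = 1 - 2 * (sin (x / 2))\<^sup>2"
    using cos_double_sin[of "x / 2"] by simp
  ultimately show ?thesis by (simp add: power_divide)
qed

lemma one_minus_cos_ge:
  fixes x :: real
  assumes "0 \<le> x" "x \<le> pi"
  shows "x\<^sup>2 / 12 \<le> 1 - cos x"
proof -
  have "\<bar>x\<bar> \<le> pi" using assms by simp
  obtain t where "cos x = (\<Sum>m<4. cos_coeff m * x ^ m) + (cos (t + 1/2 * real 4 * pi) / fact 4) * x ^ 4"
    using Maclaurin_cos_expansion[of x 4] by blast
  moreover have "(\<Sum>m<4. cos_coeff m * x ^ m) = 1 - x\<^sup>2 / 2"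
    by (simp add: cos_coeff_def lessThan_nat_numeral lessThan_Suc)
  ultimately have "cos x = 1 - x\<^sup>2 / 2 + cos (t + 2 * pi) / 24 * x ^ 4"
    by (simp add: fact_numeral)
  also have "\<dots> \<le> 1 - x\<^sup>2 / 2 + 1 / 24 * x ^ 4"
    by (intro add_left_mono mult_right_mono) auto
  also have "x ^ 4 \<le> 10 * x\<^sup>2"
  proof -
    have "pi \<le> 3.15" using pi_approx by simp
    then have "x\<^sup>2 \<le> 3.15\<^sup>2" using assms by (intro power_mono) auto
    then have "x\<^sup>2 \<le> 10" by (simp add: power2_eq_square)
    then have "x\<^sup>2 * x\<^sup>2 \<le> 10 * x\<^sup>2" by (intro mult_right_mono) auto
    then show ?thesis by (simp add: power4_eq_xxxx power2_eq_square mult.assoc)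
  qed
  finally show ?thesis by simp
qed

lemma tendsto_one_minus_cos:
  fixes y :: "nat \<Rightarrow> real"
  assumes "y \<longlonglongrightarrow> 0" "\<And>k. 0 < y k"
  shows "(\<lambda>k. (1 - cos (b * y k)) / (y k)\<^sup>2) \<longlonglongrightarrow> b\<^sup>2 / 2"
proof -
  have "((\<lambda>x. sin (b / 2 * x)) has_field_derivative b / 2) (at 0)"
    by (auto intro!: derivative_eq_intros)
  then have "((\<lambda>x. sin (b / 2 * x) / x) \<longlongrightarrow> b / 2) (at 0)"
    by (simp add: has_field_derivative_iff)
  moreover have "filterlim y (at 0) sequentially"
    using assms by (auto simp: filterlim_at less_imp_neq[symmetric] eventually_sequentially)
  ultimately have "(\<lambda>k. sin (b / 2 * y k) / y k) \<longlonglongrightarrow> b / 2"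
    by (rule filterlim_compose)
  then have "(\<lambda>k. 2 * (sin (b / 2 * y k) / y k)\<^sup>2) \<longlonglongrightarrow> 2 * (b / 2)\<^sup>2"
    by (rule tendsto_mult[OF tendsto_const tendsto_power])
  moreover have "2 * (sin (b / 2 * y k) / y k)\<^sup>2 = (1 - cos (b * y k)) / (y k)\<^sup>2" for k
    using cos_double_sin[of "b / 2 * y k"] by (simp add: power_divide)
  ultimately have "(\<lambda>k. (1 - cos (b * y k)) / (y k)\<^sup>2) \<longlonglongrightarrow> 2 * (b / 2)\<^sup>2"
    by (simp only:)
  then show ?thesis by (simp add: power_divide)
qed

lemma tendsto_one_minus_power:
  fixes z :: "nat \<Rightarrow> real" and n :: "nat \<Rightarrow> nat"
  assumes z: "z \<longlonglongrightarrow> 0" "\<And>k. 0 \<le> z k" and L: "(\<lambda>k. real (n k) * z k) \<longlonglongrightarrow> L"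
  shows "(\<lambda>k. (1 - z k) ^ n k) \<longlonglongrightarrow> exp (- L)"
proof (rule tendsto_sandwich)
  have ev: "eventually (\<lambda>k. z k < 1 / 2) sequentially"
    using z(1) by (rule order_tendstoD) simp
  show "eventually (\<lambda>k. exp (- (real (n k) * z k / (1 - z k))) \<le> (1 - z k) ^ n k) sequentially"
    using ev
  proof eventually_elim
    case (elim k)
    have "inverse (1 - z k) \<le> exp (z k / (1 - z k))"
      using exp_ge_add_one_self[of "z k / (1 - z k)"] elim by (simp add: field_simps)
    then have "exp (- (z k / (1 - z k))) \<le> 1 - z k"
      using elim by (simp add: exp_minus field_simps)
    then have "exp (- (z k / (1 - z k))) ^ n k \<le> (1 - z k) ^ n k"
      by (intro power_mono) auto
    then show ?case by (simp add: exp_of_nat_mult[symmetric])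
  qed
  show "eventually (\<lambda>k. (1 - z k) ^ n k \<le> exp (- (real (n k) * z k))) sequentially"
    using ev
  proof eventually_elim
    case (elim k)
    have "(1 - z k) ^ n k \<le> exp (- z k) ^ n k"
      using elim exp_ge_add_one_self[of "- z k"] by (intro power_mono) auto
    then show ?case by (simp add: exp_of_nat_mult[symmetric])
  qed
  have "(\<lambda>k. exp (- (real (n k) * z k / (1 - z k)))) \<longlonglongrightarrow> exp (- (L / (1 - 0)))"
    by (intro tendsto_intros L z) simp
  then show "(\<lambda>k. exp (- (real (n k) * z k / (1 - z k)))) \<longlonglongrightarrow> exp (- L)" by simp
  show "(\<lambda>k. exp (- (real (n k) * z k))) \<longlonglongrightarrow> exp (- L)"
    by (intro tendsto_intros L)
qed

lemma has_bochner_integral_gaussian_moment: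
  fixes c :: real
  assumes "0 < c"
  shows "has_bochner_integral lborel (\<lambda>x. indicator {0..} x * (exp (- (c * x\<^sup>2)) * x ^ (2 * k)))
    (sqrt pi / 2 * (fact (2 * k) / (2 ^ (2 * k) * fact k)) / (c ^ k * sqrt c))"
proof -
  define d where "d = sqrt c"
  have d: "0 < d" "d\<^sup>2 = c" using assms by (auto simp: d_def)
  have "has_bochner_integral lborel (\<lambda>x. indicator {0..} (0 + d * x) *\<^sub>R (exp (- (0 + d * x)\<^sup>2) * (0 + d * x) ^ (2 * k)))
    (sqrt pi / 2 * (fact (2 * k) / (2 ^ (2 * k) * fact k)) /\<^sub>R \<bar>d\<bar>)"
    using lborel_has_bochner_integral_real_affine_iff[of d "\<lambda>x. indicator {0..} x *\<^sub>R (exp (- x\<^sup>2) * x ^ (2 * k))" "sqrt pi / 2 * (fact (2 * k) / (2 ^ (2 * k) * fact k))" 0]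
      gaussian_moment_even_pos[of k] d by simp
  then have "has_bochner_integral lborel (\<lambda>x. 1 / c ^ k * (indicator {0..} (0 + d * x) *\<^sub>R (exp (- (0 + d * x)\<^sup>2) * (0 + d * x) ^ (2 * k))))
    (1 / c ^ k * (sqrt pi / 2 * (fact (2 * k) / (2 ^ (2 * k) * fact k)) /\<^sub>R \<bar>d\<bar>))"
    by (rule has_bochner_integral_mult_right)
  also have "(\<lambda>x. 1 / c ^ k * (indicator {0..} (0 + d * x) *\<^sub>R (exp (- (0 + d * x)\<^sup>2) * (0 + d * x) ^ (2 * k))))
     = (\<lambda>x. indicator {0..} x * (exp (- (c * x\<^sup>2)) * x ^ (2 * k)))"
  proof
    fix x :: real
    have "d ^ (2 * k) = c ^ k"
      using d by (simp add: power_mult)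
    moreover have "indicator {0..} (d * x) = (indicator {0..} x :: real)"
      using d by (auto simp: indicator_def zero_le_mult_iff)
    ultimately show "1 / c ^ k * (indicator {0..} (0 + d * x) *\<^sub>R (exp (- (0 + d * x)\<^sup>2) * (0 + d * x) ^ (2 * k)))
      = indicator {0..} x * (exp (- (c * x\<^sup>2)) * x ^ (2 * k))"
      using assms d by (simp add: power_mult_distrib)
  qed
  finally show ?thesis using d assms by (simp add: d_def field_simps)
qed

lemma walk_cf_nonneg: "0 \<le> s \<Longrightarrow> s \<le> 1 / 4 \<Longrightarrow> 0 \<le> walk_cf s \<theta>"
  using mult_mono[of s "1 / 4" "1 - cos \<theta>" 2] by (simp add: walk_cf_def)

lemma walk_cf_power_le:
  assumes "0 \<le> s" "s \<le> 1 / 4" "0 \<le> \<theta>" "\<theta> \<le> pi"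
  shows "walk_cf s \<theta> ^ n \<le> exp (- (real n * s * \<theta>\<^sup>2 / 6))"
proof -
  have "s * (\<theta>\<^sup>2 / 12) \<le> s * (1 - cos \<theta>)"
    using assms one_minus_cos_ge by (intro mult_left_mono) auto
  then have "walk_cf s \<theta> \<le> 1 + (- (s * \<theta>\<^sup>2 / 6))"
    by (simp add: walk_cf_def)
  also have "\<dots> \<le> exp (- (s * \<theta>\<^sup>2 / 6))" by (rule exp_ge_add_one_self)
  finally have "walk_cf s \<theta> ^ n \<le> exp (- (s * \<theta>\<^sup>2 / 6)) ^ n"
    using assms walk_cf_nonneg by (intro power_mono) auto
  then show ?thesis by (simp add: exp_of_nat_mult[symmetric] mult_ac)
qed

lemma walk_cf_power_tendsto:
  assumes s: "s \<longlonglongrightarrow> \<sigma>" "\<And>k. 0 \<le> s k"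
    and y: "y \<longlonglongrightarrow> 0" "\<And>k. 0 < y k"
    and n: "(\<lambda>k. real (n k) * (y k)\<^sup>2) \<longlonglongrightarrow> L"
  shows "(\<lambda>k. walk_cf (s k) (y k * t) ^ n k) \<longlonglongrightarrow> exp (- (L * \<sigma> * t\<^sup>2))"
proof -
  have c: "(\<lambda>k. (1 - cos (t * y k)) / (y k)\<^sup>2) \<longlonglongrightarrow> t\<^sup>2 / 2"
    by (rule tendsto_one_minus_cos[OF y])
  have eq: "2 * s k * (1 - cos (y k * t)) = 2 * s k * (y k)\<^sup>2 * ((1 - cos (t * y k)) / (y k)\<^sup>2)" for k
    using y(2)[of k] by (simp add: mult.commute[of t])
  have "(\<lambda>k. (1 - 2 * s k * (1 - cos (y k * t))) ^ n k) \<longlonglongrightarrow> exp (- (L * \<sigma> * t\<^sup>2))"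
  proof (rule tendsto_one_minus_power)
    have "(\<lambda>k. 2 * s k * (y k)\<^sup>2 * ((1 - cos (t * y k)) / (y k)\<^sup>2)) \<longlonglongrightarrow> 2 * \<sigma> * 0\<^sup>2 * (t\<^sup>2 / 2)"
      by (intro tendsto_mult tendsto_const tendsto_power s y c)
    then show "(\<lambda>k. 2 * s k * (1 - cos (y k * t))) \<longlonglongrightarrow> 0" unfolding eq by simp
    show "0 \<le> 2 * s k * (1 - cos (y k * t))" for k using s(2) by simp
    have "(\<lambda>k. 2 * s k * (real (n k) * (y k)\<^sup>2) * ((1 - cos (t * y k)) / (y k)\<^sup>2)) \<longlonglongrightarrow> 2 * \<sigma> * L * (t\<^sup>2 / 2)"
      by (intro tendsto_mult tendsto_const s n c)
    moreover have "real (n k) * (2 * s k * (y k)\<^sup>2 * z) = 2 * s k * (real (n k) * (y k)\<^sup>2) * z" for k z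
      by (simp add: mult_ac)
    moreover have "2 * \<sigma> * L * (t\<^sup>2 / 2) = L * \<sigma> * t\<^sup>2" by simp
    ultimately show "(\<lambda>k. real (n k) * (2 * s k * (1 - cos (y k * t)))) \<longlonglongrightarrow> L * \<sigma> * t\<^sup>2"
      unfolding eq by (simp only:)
  qed
  then show ?thesis by (simp add: walk_cf_def)
qed

lemma laplace_limit:
  fixes f :: "nat \<Rightarrow> real \<Rightarrow> real"
  assumes s: "s \<longlonglongrightarrow> \<sigma>" "0 < \<sigma>" "\<And>k. 0 \<le> s k" "\<And>k. s k \<le> 1 / 4"
    and y: "y \<longlonglongrightarrow> 0" "\<And>k. 0 < y k"
    and n: "(\<lambda>k. real (n k) * (y k)\<^sup>2) \<longlonglongrightarrow> L" "0 < L"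
    and f [measurable]: "\<And>k. f k \<in> borel_measurable borel"
    and bound: "\<And>k t. \<bar>f k t\<bar> \<le> C * (1 + t ^ 4)"
    and g: "\<And>t. (\<lambda>k. f k t) \<longlonglongrightarrow> g t"
  shows "(\<lambda>k. LINT t|lborel. indicator {0..pi / y k} t * (walk_cf (s k) (y k * t) ^ n k * f k t)) \<longlonglongrightarrow>
    (LINT t|lborel. indicator {0..} t * (exp (- (L * \<sigma> * t\<^sup>2)) * g t))"
proof -
  define c where "c = L * \<sigma> / 24"
  have c: "0 < c" using s n by (simp add: c_def)
  have "eventually (\<lambda>k. \<sigma> / 2 < s k) sequentially"
    by (rule order_tendstoD(1)[OF s(1)]) (use s in simp)
  moreover have "eventually (\<lambda>k. L / 2 < real (n k) * (y k)\<^sup>2) sequentially"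
    by (rule order_tendstoD(1)[OF n(1)]) (use n in simp)
  ultimately have "eventually (\<lambda>k. \<sigma> / 2 < s k \<and> L / 2 < real (n k) * (y k)\<^sup>2) sequentially"
    by (rule eventually_conj)
  then obtain K where K: "\<sigma> / 2 < s k" "L / 2 < real (n k) * (y k)\<^sup>2" if "k \<ge> K" for k
    by (auto simp: eventually_sequentially)
  have walk_cf [measurable]: "walk_cf s \<in> borel_measurable borel" for s
    using borel_measurable_continuous_onI[OF continuous_on_walk_cf[OF continuous_on_id]] by simp
  have [measurable]: "g \<in> borel_measurable borel"
    by (rule borel_measurable_LIMSEQ_real[OF g f])
  have "(\<lambda>k. LINT t|lborel. indicator {0..pi / y (k + K)} t *
      (walk_cf (s (k + K)) (y (k + K) * t) ^ n (k + K) * f (k + K) t)) \<longlonglongrightarrow>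
    (LINT t|lborel. indicator {0..} t * (exp (- (L * \<sigma> * t\<^sup>2)) * g t))"
  proof (rule integral_dominated_convergence[where
        w = "\<lambda>t. C * (indicator {0..} t * (exp (- (c * t\<^sup>2)) * t ^ (2 * 0)) + indicator {0..} t * (exp (- (c * t\<^sup>2)) * t ^ (2 * 2)))"])
    show "integrable lborel (\<lambda>t. C * (indicator {0..} t * (exp (- (c * t\<^sup>2)) * t ^ (2 * 0)) + indicator {0..} t * (exp (- (c * t\<^sup>2)) * t ^ (2 * 2))))"
      by (rule integrable_mult_right, rule Bochner_Integration.integrable_add;
          rule has_bochner_integral_gaussian_moment[OF c, THEN integrable.intros])
    show "AE t in lborel. (\<lambda>k. indicator {0..pi / y (k + K)} t *
        (walk_cf (s (k + K)) (y (k + K) * t) ^ n (k + K) * f (k + K) t)) \<longlonglongrightarrow>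
      indicator {0..} t * (exp (- (L * \<sigma> * t\<^sup>2)) * g t)"
    proof (rule AE_I2)
      fix t :: real
      have "eventually (\<lambda>k. indicator {0..pi / y k} t = (indicator {0..} t :: real)) sequentially"
      proof -
        have "(\<lambda>k. y k * t) \<longlonglongrightarrow> 0 * t" by (intro tendsto_intros y)
        then have "eventually (\<lambda>k. y k * t < pi) sequentially"
          by (rule order_tendstoD) simp
        then show ?thesis
        proof eventually_elim
          case (elim k)
          then show ?case using y(2)[of k] by (auto simp: indicator_def field_simps)
        qed
      qed
      then have ind: "(\<lambda>k. indicator {0..pi / y k} t :: real) \<longlonglongrightarrow> indicator {0..} t"
        by (rule tendsto_eventually)
      have "(\<lambda>k. indicator {0..pi / y k} t * (walk_cf (s k) (y k * t) ^ n k * f k t)) \<longlonglongrightarrow>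
          indicator {0..} t * (exp (- (L * \<sigma> * t\<^sup>2)) * g t)"
        by (intro tendsto_mult ind g walk_cf_power_tendsto s y n)
      then show "(\<lambda>k. indicator {0..pi / y (k + K)} t *
        (walk_cf (s (k + K)) (y (k + K) * t) ^ n (k + K) * f (k + K) t)) \<longlonglongrightarrow>
      indicator {0..} t * (exp (- (L * \<sigma> * t\<^sup>2)) * g t)"
        by (rule LIMSEQ_ignore_initial_segment)
    qed
    show "AE t in lborel. norm (indicator {0..pi / y (k + K)} t *
        (walk_cf (s (k + K)) (y (k + K) * t) ^ n (k + K) * f (k + K) t))
      \<le> C * (indicator {0..} t * (exp (- (c * t\<^sup>2)) * t ^ (2 * 0)) + indicator {0..} t * (exp (- (c * t\<^sup>2)) * t ^ (2 * 2)))" for k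
    proof (rule AE_I2)
      fix t :: real
      let ?k = "k + K"
      have C: "0 \<le> C" using order_trans[OF abs_ge_zero bound[of 0 0]] by simp
      show "norm (indicator {0..pi / y ?k} t * (walk_cf (s ?k) (y ?k * t) ^ n ?k * f ?k t))
      \<le> C * (indicator {0..} t * (exp (- (c * t\<^sup>2)) * t ^ (2 * 0)) + indicator {0..} t * (exp (- (c * t\<^sup>2)) * t ^ (2 * 2)))"
      proof (cases "t \<in> {0..pi / y ?k}")
        case False
        then show ?thesis using C by simp
      next
        case True
        then have t: "0 \<le> y ?k * t" "y ?k * t \<le> pi" "0 \<le> t"
          using y(2)[of ?k] by (auto simp: field_simps)
        have "L / 2 * (\<sigma> / 2) \<le> real (n ?k) * (y ?k)\<^sup>2 * s ?k"
          using K[of ?k] s n by (intro mult_mono) auto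
        then have "L / 2 * (\<sigma> / 2) * (t\<^sup>2 / 6) \<le> real (n ?k) * (y ?k)\<^sup>2 * s ?k * (t\<^sup>2 / 6)"
          by (rule mult_right_mono) simp
        then have le: "c * t\<^sup>2 \<le> real (n ?k) * s ?k * (y ?k * t)\<^sup>2 / 6"
          by (simp add: c_def power_mult_distrib mult_ac)
        have "walk_cf (s ?k) (y ?k * t) ^ n ?k \<le> exp (- (real (n ?k) * s ?k * (y ?k * t)\<^sup>2 / 6))"
          by (rule walk_cf_power_le[OF s(3,4) t(1,2)])
        also have "\<dots> \<le> exp (- (c * t\<^sup>2))" using le by simp
        finally have "walk_cf (s ?k) (y ?k * t) ^ n ?k * \<bar>f ?k t\<bar> \<le> exp (- (c * t\<^sup>2)) * (C * (1 + t ^ 4))"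
          using bound by (intro mult_mono) auto
        then show ?thesis
          using True t walk_cf_nonneg[OF s(3,4)] by (simp add: abs_mult algebra_simps)
      qed
    qed
  qed measurable
  then show ?thesis by (rule LIMSEQ_offset)
qed

lemma set_integral_rescale:
  fixes f :: "real \<Rightarrow> real"
  assumes "(f has_integral I) {0..pi}" "continuous_on {0..pi} f" "0 < y"
  shows "(LINT t|lborel. indicator {0..pi / y} t * f (y * t)) = I / y"
proof -
  have "I = (LINT \<theta>|lborel. indicator {0..pi} \<theta> *\<^sub>R f \<theta>)"
    using set_borel_integral_eq_integral(2)[OF borel_integrable_atLeastAtMost'[OF assms(2)]] integral_unique[OF assms(1)]
    by (simp add: set_lebesgue_integral_def)
  also have "\<dots> = \<bar>y\<bar> *\<^sub>R (LINT t|lborel. indicator {0..pi} (0 + y * t) *\<^sub>R f (0 + y * t))"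
    by (rule lborel_integral_real_affine) (use assms in simp)
  also have "(\<lambda>t. indicator {0..pi} (0 + y * t) *\<^sub>R f (0 + y * t)) = (\<lambda>t. indicator {0..pi / y} t * f (y * t))"
    using assms(3) by (auto simp: fun_eq_iff indicator_def field_simps zero_le_mult_iff)
  finally show ?thesis using assms(3) by (simp add: field_simps)
qed

definition kernel_defect :: "real \<Rightarrow> nat \<Rightarrow> real \<Rightarrow> real" where
  "kernel_defect \<alpha> r \<theta> = binom_mean \<alpha> r (\<lambda>j. \<Sum>i<j. 1 - cos (real i * \<theta>))"

definition kernel_curvature :: "real \<Rightarrow> nat \<Rightarrow> real" where
  "kernel_curvature \<alpha> r = binom_mean \<alpha> r (\<lambda>j. \<Sum>i<j. (real i)\<^sup>2 / 2)"

lemma race_kernel_eq: "race_kernel \<alpha> r \<theta> = (real r * \<alpha> - 1 / 2) - kernel_defect \<alpha> r \<theta>"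
proof -
  have "race_kernel \<alpha> r \<theta> = binom_mean \<alpha> r (\<lambda>j. (real j - 1 / 2) - (\<Sum>i<j. 1 - cos (real i * \<theta>)))"
    unfolding race_kernel_def by (simp add: sum_subtractf)
  then show ?thesis
    by (simp add: binom_mean_diff binom_mean_const binom_mean_id kernel_defect_def)
qed

lemma kernel_defect_bounds:
  assumes "0 < \<alpha>" "\<alpha> < 1"
  shows "0 \<le> kernel_defect \<alpha> r \<theta>" "kernel_defect \<alpha> r \<theta> \<le> real r ^ 3 * \<theta>\<^sup>2"
proof -
  have "binom_mean \<alpha> r (\<lambda>j. 0) \<le> kernel_defect \<alpha> r \<theta>"
    unfolding kernel_defect_def using assms by (intro binom_mean_mono sum_nonneg) auto
  then show "0 \<le> kernel_defect \<alpha> r \<theta>" by (simp add: binom_mean_const)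
  have "kernel_defect \<alpha> r \<theta> \<le> binom_mean \<alpha> r (\<lambda>j. real r ^ 3 * \<theta>\<^sup>2)"
    unfolding kernel_defect_def
  proof (intro binom_mean_mono)
    fix j assume j: "j \<le> r"
    have "(\<Sum>i<j. 1 - cos (real i * \<theta>)) \<le> (\<Sum>i<j. (real r)\<^sup>2 * \<theta>\<^sup>2)"
    proof (rule sum_mono)
      fix i assume "i \<in> {..<j}"
      then have "(real i)\<^sup>2 \<le> (real r)\<^sup>2" using j by (intro power_mono) auto
      then have "(real i)\<^sup>2 * \<theta>\<^sup>2 \<le> (real r)\<^sup>2 * \<theta>\<^sup>2" by (rule mult_right_mono) simp
      moreover have "(real i * \<theta>)\<^sup>2 / 2 \<le> (real i)\<^sup>2 * \<theta>\<^sup>2"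
        by (simp add: power_mult_distrib)
      ultimately show "1 - cos (real i * \<theta>) \<le> (real r)\<^sup>2 * \<theta>\<^sup>2"
        using one_minus_cos_le[of "real i * \<theta>"] by linarith
    qed
    also have "\<dots> \<le> real r * ((real r)\<^sup>2 * \<theta>\<^sup>2)"
      using j by (auto intro!: mult_right_mono)
    finally show "(\<Sum>i<j. 1 - cos (real i * \<theta>)) \<le> real r ^ 3 * \<theta>\<^sup>2"
      by (simp add: power3_eq_cube power2_eq_square mult_ac)
  qed (use assms in auto)
  then show "kernel_defect \<alpha> r \<theta> \<le> real r ^ 3 * \<theta>\<^sup>2" by (simp add: binom_mean_const)
qed

lemma kernel_defect_tendsto:
  assumes "\<alpha> \<longlonglongrightarrow> a" "y \<longlonglongrightarrow> 0" "\<And>k. 0 < y k"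
  shows "(\<lambda>k. kernel_defect (\<alpha> k) r (y k * t) / (y k)\<^sup>2) \<longlonglongrightarrow> t\<^sup>2 * kernel_curvature a r"
proof -
  have "(\<lambda>k. binom_mean (\<alpha> k) r (\<lambda>j. \<Sum>i<j. (1 - cos (real i * t * y k)) / (y k)\<^sup>2)) \<longlonglongrightarrow>
      binom_mean a r (\<lambda>j. \<Sum>i<j. (real i * t)\<^sup>2 / 2)"
    unfolding binom_mean_def
    by (intro tendsto_sum tendsto_mult tendsto_power tendsto_diff tendsto_const tendsto_one_minus_cos assms)
  moreover have "binom_mean (\<alpha> k) r (\<lambda>j. \<Sum>i<j. (1 - cos (real i * t * y k)) / (y k)\<^sup>2)
      = kernel_defect (\<alpha> k) r (y k * t) / (y k)\<^sup>2" for k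
    using binom_mean_cmult[of "\<alpha> k" r "1 / (y k)\<^sup>2" "\<lambda>j. \<Sum>i<j. 1 - cos (real i * (y k * t))"]
    by (simp add: kernel_defect_def sum_divide_distrib mult_ac)
  moreover have "binom_mean a r (\<lambda>j. \<Sum>i<j. (real i * t)\<^sup>2 / 2) = t\<^sup>2 * kernel_curvature a r"
    by (simp add: kernel_curvature_def binom_mean_cmult[symmetric] sum_distrib_left power_mult_distrib mult_ac)
  ultimately show ?thesis by simp
qed

lemma kernel_curvature_eq:
  "kernel_curvature \<alpha> r =
     real r * (real r - 1) * (real r - 2) * \<alpha> ^ 3 / 6 + real r * (real r - 1) * \<alpha>\<^sup>2 / 4"
proof -
  have s: "(\<Sum>i<j. (real i)\<^sup>2 / 2) = (2 * real j ^ 3 - 3 * (real j)\<^sup>2 + real j) / 12" for j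
    by (induction j) (simp_all add: field_simps power2_eq_square power3_eq_cube)
  have m2: "binom_mean \<alpha> r (\<lambda>j. (real j)\<^sup>2) = real r * (real r - 1) * \<alpha>\<^sup>2 + real r * \<alpha>" for r
  proof (induction r)
    case (Suc r)
    have "(\<lambda>j. (real (Suc j))\<^sup>2) = (\<lambda>j. (real j)\<^sup>2 + 2 * real j + 1)"
      by (simp add: fun_eq_iff power2_eq_square algebra_simps)
    then show ?case
      by (simp only: binom_mean_Suc binom_mean_add binom_mean_const binom_mean_cmult binom_mean_id Suc)
        (simp add: power2_eq_square algebra_simps)
  qed simp
  have m3: "binom_mean \<alpha> r (\<lambda>j. real j ^ 3) =
      real r * (real r - 1) * (real r - 2) * \<alpha> ^ 3 + 3 * (real r * (real r - 1) * \<alpha>\<^sup>2) + real r * \<alpha>" for r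
  proof (induction r)
    case (Suc r)
    have "(\<lambda>j. real (Suc j) ^ 3) = (\<lambda>j. real j ^ 3 + 3 * (real j)\<^sup>2 + 3 * real j + 1)"
      by (simp add: fun_eq_iff power3_eq_cube power2_eq_square algebra_simps)
    then show ?case
      by (simp only: binom_mean_Suc binom_mean_add binom_mean_const binom_mean_cmult binom_mean_id m2 Suc)
        (simp add: power3_eq_cube power2_eq_square algebra_simps)
  qed simp
  have "kernel_curvature \<alpha> r = binom_mean \<alpha> r (\<lambda>j. 1 / 12 * (2 * real j ^ 3 - 3 * (real j)\<^sup>2 + real j))"
    unfolding kernel_curvature_def s by simp
  also have "\<dots> = 1 / 12 * (2 * binom_mean \<alpha> r (\<lambda>j. real j ^ 3) - 3 * binom_mean \<alpha> r (\<lambda>j. (real j)\<^sup>2) + binom_mean \<alpha> r real)"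
    unfolding binom_mean_cmult binom_mean_add binom_mean_diff ..
  also have "\<dots> = real r * (real r - 1) * (real r - 2) * \<alpha> ^ 3 / 6 + real r * (real r - 1) * \<alpha>\<^sup>2 / 4"
    unfolding m2 m3 binom_mean_id by (simp add: field_simps)
  finally show ?thesis .
qed

lemma gaussian_combination:
  fixes p q :: real
  assumes "0 < p" "0 < q" "p\<^sup>2 = P" "q\<^sup>2 = b"
  shows "h * (p / 2 * (fact (2 * 0) / (2 ^ (2 * 0) * fact 0)) / (b ^ 0 * q))
      - c * (p / 2 * (fact (2 * 1) / (2 ^ (2 * 1) * fact 1)) / (b ^ 1 * q))
      = P * ((h - c / (2 * b)) / (2 * (p * q)))"
    and "\<sigma> * h * (p / 2 * (fact (2 * 1) / (2 ^ (2 * 1) * fact 1)) / (b ^ 1 * q))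
      - \<sigma> * c * (p / 2 * (fact (2 * 2) / (2 ^ (2 * 2) * fact 2)) / (b ^ 2 * q))
      = P * (\<sigma> / (4 * b * (p * q)) * (h - 3 * c / (2 * b)))"
proof -
  have b: "0 < b" using assms by auto
  have f: "fact (2 * 2) = (24 :: real)" by (simp add: fact_numeral)
  show "h * (p / 2 * (fact (2 * 0) / (2 ^ (2 * 0) * fact 0)) / (b ^ 0 * q))
      - c * (p / 2 * (fact (2 * 1) / (2 ^ (2 * 1) * fact 1)) / (b ^ 1 * q))
      = P * ((h - c / (2 * b)) / (2 * (p * q)))"
    unfolding assms(3)[symmetric] using assms(1,2) b
    by (simp add: field_simps power2_eq_square)
  show "\<sigma> * h * (p / 2 * (fact (2 * 1) / (2 ^ (2 * 1) * fact 1)) / (b ^ 1 * q))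
      - \<sigma> * c * (p / 2 * (fact (2 * 2) / (2 ^ (2 * 2) * fact 2)) / (b ^ 2 * q))
      = P * (\<sigma> / (4 * b * (p * q)) * (h - 3 * c / (2 * b)))"
    unfolding assms(3)[symmetric] f using assms(1,2) b
    by (simp add: field_simps power2_eq_square)
qed

text \<open>
  The scales \<open>y\<close> of the angle and \<open>e\<close> of the kernel are kept apart to cover both \<open>\<alpha>\<close> fixed
  (\<open>e = 1\<close>, \<open>\<rho> = 0\<close>) and the critical regime (\<open>e = y\<^sup>2\<close>, \<open>\<rho> = 1\<close>).
\<close>

locale race_scaling =
  fixes \<alpha> y e :: "nat \<Rightarrow> real" and n :: "nat \<Rightarrow> nat" and a L h \<rho> :: real and r :: nat
  assumes \<alpha>: "\<alpha> \<longlonglongrightarrow> a" "\<And>k. 0 < \<alpha> k" "\<And>k. \<alpha> k < 1" and a: "0 < a" "a < 1"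
    and y: "y \<longlonglongrightarrow> 0" "\<And>k. 0 < y k"
    and n: "(\<lambda>k. real (n k) * (y k)\<^sup>2) \<longlonglongrightarrow> L" and L: "0 < L"
    and e: "\<And>k. 0 < e k"
    and h: "(\<lambda>k. (real r * \<alpha> k - 1 / 2) / e k) \<longlonglongrightarrow> h"
    and \<rho>: "(\<lambda>k. (y k)\<^sup>2 / e k) \<longlonglongrightarrow> \<rho>"
begin

definition s where "s k = \<alpha> k * (1 - \<alpha> k)"

definition \<sigma> where "\<sigma> = a * (1 - a)"

lemma s_bounds: "0 < s k" "s k \<le> 1 / 4" and \<sigma>_pos: "0 < \<sigma>" and s_tendsto: "s \<longlonglongrightarrow> \<sigma>"
proof -
  show "0 < s k" "s k \<le> 1 / 4" "0 < \<sigma>"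
    unfolding s_def \<sigma>_def by (intro variance_bounds \<alpha> a)+
  show "s \<longlonglongrightarrow> \<sigma>" unfolding s_def[abs_def] \<sigma>_def by (intro tendsto_intros \<alpha>)
qed

lemma kernel_quotient_bound:
  obtains C where "0 \<le> C" "\<And>k t. \<bar>race_kernel (\<alpha> k) r (y k * t) / e k\<bar> \<le> C * (1 + t\<^sup>2)"
proof -
  obtain A where A: "\<And>k. norm ((real r * \<alpha> k - 1 / 2) / e k) \<le> A"
    using convergent_imp_Bseq[OF convergentI[OF h]] unfolding Bseq_def by blast
  obtain B where B: "\<And>k. norm ((y k)\<^sup>2 / e k) \<le> B"
    using convergent_imp_Bseq[OF convergentI[OF \<rho>]] unfolding Bseq_def by blast
  have pos: "0 \<le> A" "0 \<le> B" using norm_ge_zero A B by (blast intro: order_trans)+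
  show ?thesis
  proof (rule that)
    show "0 \<le> A + real r ^ 3 * B" using pos by simp
    fix k t
    note kd = kernel_defect_bounds[OF \<alpha>(2,3), of k r "y k * t"]
    have "kernel_defect (\<alpha> k) r (y k * t) / e k \<le> real r ^ 3 * (y k * t)\<^sup>2 / e k"
      using kd e[of k] by (intro divide_right_mono) auto
    also have "\<dots> = real r ^ 3 * t\<^sup>2 * ((y k)\<^sup>2 / e k)" by (simp add: power_mult_distrib)
    also have "\<dots> \<le> real r ^ 3 * t\<^sup>2 * B" using B[of k] e[of k] by (intro mult_left_mono) auto
    finally have "\<bar>kernel_defect (\<alpha> k) r (y k * t) / e k\<bar> \<le> real r ^ 3 * t\<^sup>2 * B"
      using kd e[of k] by simp
    moreover have "race_kernel (\<alpha> k) r (y k * t) / e k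
        = (real r * \<alpha> k - 1 / 2) / e k - kernel_defect (\<alpha> k) r (y k * t) / e k"
      by (simp add: race_kernel_eq diff_divide_distrib)
    ultimately have "\<bar>race_kernel (\<alpha> k) r (y k * t) / e k\<bar> \<le> A + real r ^ 3 * t\<^sup>2 * B"
      using A[of k] by (simp only: real_norm_def)
    also have "\<dots> \<le> (A + real r ^ 3 * B) * (1 + t\<^sup>2)"
      using pos by (simp add: algebra_simps)
    finally show "\<bar>race_kernel (\<alpha> k) r (y k * t) / e k\<bar> \<le> (A + real r ^ 3 * B) * (1 + t\<^sup>2)" .
  qed
qed

lemma scaled_integral_tendsto:
  assumes "m \<le> 1"
  shows "(\<lambda>k. LINT t|lborel. indicator {0..pi / y k} t * (walk_cf (s k) (y k * t) ^ n k *
      (((1 - walk_cf (s k) (y k * t)) / (y k)\<^sup>2) ^ m * (race_kernel (\<alpha> k) r (y k * t) / e k)))) \<longlonglongrightarrow>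
    (LINT t|lborel. indicator {0..} t * (exp (- (L * \<sigma> * t\<^sup>2)) *
      ((\<sigma> * t\<^sup>2) ^ m * (h - \<rho> * (t\<^sup>2 * kernel_curvature a r)))))"
proof -
  obtain C where C: "0 \<le> C" "\<And>k t. \<bar>race_kernel (\<alpha> k) r (y k * t) / e k\<bar> \<le> C * (1 + t\<^sup>2)"
    using kernel_quotient_bound by metis
  have eq: "(1 - walk_cf (s k) (y k * t)) / (y k)\<^sup>2 = 2 * s k * ((1 - cos (t * y k)) / (y k)\<^sup>2)" for k t
    by (simp add: walk_cf_def mult.commute[of t])
  show ?thesis
  proof (rule laplace_limit[OF s_tendsto \<sigma>_pos less_imp_le[OF s_bounds(1)] s_bounds(2) y n L,
        where C = "2 * C"])
    show "(\<lambda>t. ((1 - walk_cf (s k) (y k * t)) / (y k)\<^sup>2) ^ m * (race_kernel (\<alpha> k) r (y k * t) / e k))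
        \<in> borel_measurable borel" for k
      by (intro borel_measurable_continuous_onI continuous_intros) (use y(2)[of k] e[of k] in auto)
    show "\<bar>((1 - walk_cf (s k) (y k * t)) / (y k)\<^sup>2) ^ m * (race_kernel (\<alpha> k) r (y k * t) / e k)\<bar>
        \<le> 2 * C * (1 + t ^ 4)" for k t
    proof -
      have "0 \<le> 2 * s k * ((1 - cos (t * y k)) / (y k)\<^sup>2)"
        using s_bounds[of k] by simp
      moreover have "2 * s k * ((1 - cos (t * y k)) / (y k)\<^sup>2) \<le> 2 * (1 / 4) * (t\<^sup>2 / 2)"
        using s_bounds[of k] y(2)[of k] one_minus_cos_le[of "t * y k"]
        by (intro mult_mono) (auto simp: power_mult_distrib field_simps)
      ultimately have "\<bar>((1 - walk_cf (s k) (y k * t)) / (y k)\<^sup>2) ^ m\<bar> \<le> 1 + t\<^sup>2"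
        unfolding eq using assms by (cases m) auto
      then have "\<bar>((1 - walk_cf (s k) (y k * t)) / (y k)\<^sup>2) ^ m\<bar> * \<bar>race_kernel (\<alpha> k) r (y k * t) / e k\<bar>
          \<le> (1 + t\<^sup>2) * (C * (1 + t\<^sup>2))"
        using C by (intro mult_mono) auto
      also have "\<dots> = C * (1 + t\<^sup>2)\<^sup>2" by (simp add: power2_eq_square)
      also have "\<dots> \<le> C * (2 * (1 + t ^ 4))"
      proof (rule mult_left_mono[OF _ C(1)])
        have "0 \<le> (t\<^sup>2 - 1)\<^sup>2" by simp
        then show "(1 + t\<^sup>2)\<^sup>2 \<le> 2 * (1 + t ^ 4)"
          by (simp add: power2_eq_square power4_eq_xxxx algebra_simps)
      qed
      also have "\<dots> = 2 * C * (1 + t ^ 4)" by simp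
      finally show ?thesis by (simp only: abs_mult)
    qed
    show "(\<lambda>k. ((1 - walk_cf (s k) (y k * t)) / (y k)\<^sup>2) ^ m * (race_kernel (\<alpha> k) r (y k * t) / e k)) \<longlonglongrightarrow>
      (\<sigma> * t\<^sup>2) ^ m * (h - \<rho> * (t\<^sup>2 * kernel_curvature a r))" for t
    proof (intro tendsto_mult tendsto_power)
      have "(\<lambda>k. 2 * s k * ((1 - cos (t * y k)) / (y k)\<^sup>2)) \<longlonglongrightarrow> 2 * \<sigma> * (t\<^sup>2 / 2)"
        by (intro tendsto_mult tendsto_const s_tendsto tendsto_one_minus_cos y)
      then show "(\<lambda>k. (1 - walk_cf (s k) (y k * t)) / (y k)\<^sup>2) \<longlonglongrightarrow> \<sigma> * t\<^sup>2"
        unfolding eq by simp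
      have "(\<lambda>k. (real r * \<alpha> k - 1 / 2) / e k - (y k)\<^sup>2 / e k * (kernel_defect (\<alpha> k) r (y k * t) / (y k)\<^sup>2))
          \<longlonglongrightarrow> h - \<rho> * (t\<^sup>2 * kernel_curvature a r)"
        by (intro tendsto_diff tendsto_mult h \<rho> kernel_defect_tendsto \<alpha> y)
      moreover have "(real r * \<alpha> k - 1 / 2) / e k - (y k)\<^sup>2 / e k * (kernel_defect (\<alpha> k) r (y k * t) / (y k)\<^sup>2)
          = race_kernel (\<alpha> k) r (y k * t) / e k" for k
        using y(2)[of k] by (simp add: race_kernel_eq diff_divide_distrib)
      ultimately show "(\<lambda>k. race_kernel (\<alpha> k) r (y k * t) / e k) \<longlonglongrightarrow> h - \<rho> * (t\<^sup>2 * kernel_curvature a r)"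
        by simp
    qed
  qed
qed

lemma b_pos: "0 < L * \<sigma>" using L \<sigma>_pos by simp

lemma race_tendsto:
  "(\<lambda>k. (race (\<alpha> k) r (n k) - 1 / 2) / (y k * e k)) \<longlonglongrightarrow>
     (h - \<rho> * kernel_curvature a r / (2 * (L * \<sigma>))) / (2 * sqrt (pi * (L * \<sigma>)))"
proof -
  let ?b = "L * \<sigma>" and ?\<kappa> = "kernel_curvature a r"
  have "(LINT t|lborel. indicator {0..pi / y k} t * (walk_cf (s k) (y k * t) ^ n k *
      (((1 - walk_cf (s k) (y k * t)) / (y k)\<^sup>2) ^ 0 * (race_kernel (\<alpha> k) r (y k * t) / e k))))
    = pi * ((race (\<alpha> k) r (n k) - 1 / 2) / (y k * e k))" for k
  proof -
    have "(LINT t|lborel. indicator {0..pi / y k} t *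
        (walk_cf (s k) (y k * t) ^ n k * race_kernel (\<alpha> k) r (y k * t)))
        = pi * (race (\<alpha> k) r (n k) - 1 / 2) / y k"
      unfolding s_def
      by (rule set_integral_rescale[OF has_integral_race]) (intro continuous_intros y)+
    then show ?thesis by (simp flip: times_divide_eq_right) (simp add: mult.assoc[symmetric])
  qed
  then have "(\<lambda>k. pi * ((race (\<alpha> k) r (n k) - 1 / 2) / (y k * e k))) \<longlonglongrightarrow>
    (LINT t|lborel. indicator {0..} t * (exp (- (?b * t\<^sup>2)) *
      ((\<sigma> * t\<^sup>2) ^ 0 * (h - \<rho> * (t\<^sup>2 * ?\<kappa>)))))"
    using scaled_integral_tendsto[of 0] by simp
  also have "(LINT t|lborel. indicator {0..} t * (exp (- (?b * t\<^sup>2)) *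
      ((\<sigma> * t\<^sup>2) ^ 0 * (h - \<rho> * (t\<^sup>2 * ?\<kappa>))))) =
    h * (sqrt pi / 2 * (fact (2 * 0) / (2 ^ (2 * 0) * fact 0)) / (?b ^ 0 * sqrt ?b))
    - \<rho> * ?\<kappa> * (sqrt pi / 2 * (fact (2 * 1) / (2 ^ (2 * 1) * fact 1)) / (?b ^ 1 * sqrt ?b))"
  proof (rule has_bochner_integral_integral_eq)
    have "has_bochner_integral lborel (\<lambda>t. h * (indicator {0..} t * (exp (- (?b * t\<^sup>2)) * t ^ (2 * 0)))
        - \<rho> * ?\<kappa> * (indicator {0..} t * (exp (- (?b * t\<^sup>2)) * t ^ (2 * 1))))
      (h * (sqrt pi / 2 * (fact (2 * 0) / (2 ^ (2 * 0) * fact 0)) / (?b ^ 0 * sqrt ?b))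
    - \<rho> * ?\<kappa> * (sqrt pi / 2 * (fact (2 * 1) / (2 ^ (2 * 1) * fact 1)) / (?b ^ 1 * sqrt ?b)))"
      by (intro has_bochner_integral_diff has_bochner_integral_mult_right has_bochner_integral_gaussian_moment b_pos)
    then show "has_bochner_integral lborel (\<lambda>t. indicator {0..} t * (exp (- (?b * t\<^sup>2)) *
        ((\<sigma> * t\<^sup>2) ^ 0 * (h - \<rho> * (t\<^sup>2 * ?\<kappa>)))))
      (h * (sqrt pi / 2 * (fact (2 * 0) / (2 ^ (2 * 0) * fact 0)) / (?b ^ 0 * sqrt ?b))
    - \<rho> * ?\<kappa> * (sqrt pi / 2 * (fact (2 * 1) / (2 ^ (2 * 1) * fact 1)) / (?b ^ 1 * sqrt ?b)))"
      by (rule has_bochner_integral_cong[THEN iffD1, rotated 3]) (auto simp: algebra_simps power2_eq_square)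
  qed
  also have "\<dots> = pi * ((h - \<rho> * ?\<kappa> / (2 * ?b)) / (2 * sqrt (pi * ?b)))"
    unfolding real_sqrt_mult[of pi ?b] by (rule gaussian_combination) (use b_pos in auto)
  finally show ?thesis
    by (rule tendsto_mult_left_iff[THEN iffD1, rotated]) simp
qed

lemma race_diff_tendsto:
  "(\<lambda>k. (race (\<alpha> k) r (n k) - race (\<alpha> k) r (Suc (n k))) / (y k ^ 3 * e k)) \<longlonglongrightarrow>
     \<sigma> / (4 * (L * \<sigma>) * sqrt (pi * (L * \<sigma>))) * (h - 3 * (\<rho> * kernel_curvature a r) / (2 * (L * \<sigma>)))"
proof -
  let ?b = "L * \<sigma>" and ?\<kappa> = "kernel_curvature a r"
  have "(LINT t|lborel. indicator {0..pi / y k} t * (walk_cf (s k) (y k * t) ^ n k *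
      (((1 - walk_cf (s k) (y k * t)) / (y k)\<^sup>2) ^ 1 * (race_kernel (\<alpha> k) r (y k * t) / e k))))
    = pi * ((race (\<alpha> k) r (n k) - race (\<alpha> k) r (Suc (n k))) / (y k ^ 3 * e k))" for k
  proof -
    have "(LINT t|lborel. indicator {0..pi / y k} t *
        (walk_cf (s k) (y k * t) ^ n k * ((1 - walk_cf (s k) (y k * t)) * race_kernel (\<alpha> k) r (y k * t))))
        = pi * (race (\<alpha> k) r (n k) - race (\<alpha> k) r (Suc (n k))) / y k"
      unfolding s_def
      by (rule set_integral_rescale[OF has_integral_race_diff]) (intro continuous_intros y)+
    then have "(LINT t|lborel. 1 / ((y k)\<^sup>2 * e k) * (indicator {0..pi / y k} t *
        (walk_cf (s k) (y k * t) ^ n k * ((1 - walk_cf (s k) (y k * t)) * race_kernel (\<alpha> k) r (y k * t)))))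
        = 1 / ((y k)\<^sup>2 * e k) * (pi * (race (\<alpha> k) r (n k) - race (\<alpha> k) r (Suc (n k))) / y k)"
      by (simp only: integral_mult_right_zero)
    then show ?thesis by (simp add: power2_eq_square power3_eq_cube mult_ac)
  qed
  then have "(\<lambda>k. pi * ((race (\<alpha> k) r (n k) - race (\<alpha> k) r (Suc (n k))) / (y k ^ 3 * e k))) \<longlonglongrightarrow>
    (LINT t|lborel. indicator {0..} t * (exp (- (?b * t\<^sup>2)) *
      ((\<sigma> * t\<^sup>2) ^ 1 * (h - \<rho> * (t\<^sup>2 * ?\<kappa>)))))"
    using scaled_integral_tendsto[of 1] by simp
  also have "(LINT t|lborel. indicator {0..} t * (exp (- (?b * t\<^sup>2)) *
      ((\<sigma> * t\<^sup>2) ^ 1 * (h - \<rho> * (t\<^sup>2 * ?\<kappa>))))) =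
    \<sigma> * h * (sqrt pi / 2 * (fact (2 * 1) / (2 ^ (2 * 1) * fact 1)) / (?b ^ 1 * sqrt ?b))
    - \<sigma> * (\<rho> * ?\<kappa>) * (sqrt pi / 2 * (fact (2 * 2) / (2 ^ (2 * 2) * fact 2)) / (?b ^ 2 * sqrt ?b))"
  proof (rule has_bochner_integral_integral_eq)
    have "has_bochner_integral lborel (\<lambda>t. \<sigma> * h * (indicator {0..} t * (exp (- (?b * t\<^sup>2)) * t ^ (2 * 1)))
        - \<sigma> * (\<rho> * ?\<kappa>) * (indicator {0..} t * (exp (- (?b * t\<^sup>2)) * t ^ (2 * 2))))
      (\<sigma> * h * (sqrt pi / 2 * (fact (2 * 1) / (2 ^ (2 * 1) * fact 1)) / (?b ^ 1 * sqrt ?b))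
    - \<sigma> * (\<rho> * ?\<kappa>) * (sqrt pi / 2 * (fact (2 * 2) / (2 ^ (2 * 2) * fact 2)) / (?b ^ 2 * sqrt ?b)))"
      by (intro has_bochner_integral_diff has_bochner_integral_mult_right has_bochner_integral_gaussian_moment b_pos)
    then show "has_bochner_integral lborel (\<lambda>t. indicator {0..} t * (exp (- (?b * t\<^sup>2)) *
        ((\<sigma> * t\<^sup>2) ^ 1 * (h - \<rho> * (t\<^sup>2 * ?\<kappa>)))))
      (\<sigma> * h * (sqrt pi / 2 * (fact (2 * 1) / (2 ^ (2 * 1) * fact 1)) / (?b ^ 1 * sqrt ?b))
    - \<sigma> * (\<rho> * ?\<kappa>) * (sqrt pi / 2 * (fact (2 * 2) / (2 ^ (2 * 2) * fact 2)) / (?b ^ 2 * sqrt ?b)))"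
      by (rule has_bochner_integral_cong[THEN iffD1, rotated 3])
        (auto simp: algebra_simps power2_eq_square power4_eq_xxxx)
  qed
  also have "\<dots> = pi * (\<sigma> / (4 * ?b * sqrt (pi * ?b)) * (h - 3 * (\<rho> * ?\<kappa>) / (2 * ?b)))"
    unfolding real_sqrt_mult[of pi ?b] by (rule gaussian_combination) (use b_pos in auto)
  finally show ?thesis
    by (rule tendsto_mult_left_iff[THEN iffD1, rotated]) simp
qed

end

section \<open>Unimodality\<close>

lemma less_if_steps_less:
  fixes f :: "nat \<Rightarrow> 'a :: order"
  assumes "i < j" "\<And>k. i \<le> k \<Longrightarrow> k < j \<Longrightarrow> f k < f (Suc k)"
  shows "f i < f j"
  using assms
proof (induction j)
  case (Suc j)
  then show ?case
    by (cases "i = j") (auto intro: less_trans[of "f i" "f j"] simp: less_Suc_eq)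
qed simp

lemma unimodal_if_sign_change:
  assumes sgn: "\<And>n. u n \<le> 0 \<Longrightarrow> u (Suc n) < 0" and u0: "0 \<le> u 0" and neg: "u m < 0"
    and diff: "\<And>n. f (Suc n) - f n = c * u n" and c: "0 < (c :: real)"
  shows "\<exists>N. unimodal_with_mode f N"
proof -
  define N where "N = (LEAST n. u n < 0)"
  have N: "u N < 0" unfolding N_def by (rule LeastI) (rule neg)
  have less_N: "0 \<le> u n" if "n < N" for n
    using not_less_Least[of n "\<lambda>n. u n < 0"] that by (simp add: N_def)
  have N1: "1 \<le> N" using N u0 by (cases N) auto
  have ge_N: "u n < 0" if "N \<le> n" for n
    using that by (induction n rule: dec_induct) (auto simp: N intro: sgn)
  have pos: "0 < u n" if "n < N - 1" for n
    using less_N[of n] less_N[of "Suc n"] sgn[of n] that by fastforce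
  have up: "f k < f (Suc k)" if "k < N - 1" for k
    using mult_pos_pos[OF c pos[OF that]] diff[of k] by linarith
  have down: "- f k < - f (Suc k)" if "N \<le> k" for k
    using mult_pos_neg[OF c ge_N[OF that]] diff[of k] by linarith
  have "unimodal_with_mode f N"
    unfolding unimodal_with_mode_def
  proof (intro conjI monotone_onI)
    show "f (N - 1) \<le> f N"
    proof -
      obtain K where K: "N = Suc K" using N1 by (cases N) auto
      have "0 \<le> c * u K" using c less_N[of K] K by simp
      then show ?thesis unfolding K diff_Suc_1 using diff[of K] by linarith
    qed
    show "f i < f j" if "i \<in> {..N - 1}" "j \<in> {..N - 1}" "i < j" for i j
      by (rule less_if_steps_less[of i j f, OF \<open>i < j\<close> up]) (use that in auto)
    show "f i > f j" if "i \<in> {N..}" "j \<in> {N..}" "i < j" for i j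
    proof -
      have "- f i < - f j"
        by (rule less_if_steps_less[of i j "\<lambda>k. - f k", OF \<open>i < j\<close> down]) (use that in simp)
      then show ?thesis by simp
    qed
  qed (rule N1)
  then show ?thesis ..
qed

lemma unimodal_less_mode:
  assumes "unimodal_with_mode f N" "f n < f (Suc n)"
  shows "n < N"
proof (rule ccontr)
  assume "\<not> n < N"
  moreover have "strict_antimono_on {N..} f"
    using assms(1) by (simp add: unimodal_with_mode_def)
  ultimately have "f (Suc n) < f n" by (auto dest: monotone_onD[of _ _ _ _ n "Suc n"])
  then show False using assms(2) by simp
qed

lemma unimodal_mode_le:
  assumes "unimodal_with_mode f N" "f (Suc n) < f n"
  shows "N \<le> n"
proof (rule ccontr)
  have uni: "strict_mono_on {..N - 1} f" "f (N - 1) \<le> f N"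
    using assms(1) by (simp_all add: unimodal_with_mode_def)
  assume "\<not> N \<le> n"
  then consider "Suc n \<le> N - 1" | "n = N - 1" "Suc n = N" by linarith
  then have "f n \<le> f (Suc n)"
  proof cases
    case 1
    then show ?thesis using monotone_onD[OF uni(1), of n "Suc n"] by simp
  next
    case 2
    then show ?thesis using uni(2) by simp
  qed
  then show False using assms(2) by simp
qed

lemma race_incr_eventually_neg:
  assumes "0 < \<alpha>" "\<alpha> < 1" "1 / 2 < real r * \<alpha>"
  shows "\<exists>n. race_incr \<alpha> r n < 0"
proof -
  interpret race_scaling "\<lambda>_. \<alpha>" "\<lambda>k. 1 / sqrt (real (Suc k))" "\<lambda>_. 1" Suc \<alpha> 1 "real r * \<alpha> - 1 / 2" 0 r
  proof
    show "(\<lambda>k. 1 / sqrt (real (Suc k))) \<longlonglongrightarrow> 0" by real_asymp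
    show "(\<lambda>k. (1 / sqrt (real (Suc k)))\<^sup>2 / 1) \<longlonglongrightarrow> 0" by real_asymp
    show "(\<lambda>k. real (Suc k) * (1 / sqrt (real (Suc k)))\<^sup>2) \<longlonglongrightarrow> 1"
      by (simp add: power_divide)
  qed (use assms in auto)
  have "0 < \<sigma> / (4 * (1 * \<sigma>) * sqrt (pi * (1 * \<sigma>))) * (real r * \<alpha> - 1 / 2 - 3 * (0 * kernel_curvature \<alpha> r) / (2 * (1 * \<sigma>)))"
    using \<sigma>_pos assms(3) by simp
  from order_tendstoD(1)[OF race_diff_tendsto this]
  obtain k where "0 < (race \<alpha> r (Suc k) - race \<alpha> r (Suc (Suc k))) / ((1 / sqrt (real (Suc k))) ^ 3 * 1)"
    by (auto simp: eventually_sequentially)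
  then have "race \<alpha> r (Suc (Suc k)) - race \<alpha> r (Suc k) < 0"
    by (simp add: zero_less_divide_iff)
  then have "race_incr \<alpha> r (Suc k) < 0"
    using less_imp_le[OF variance_bounds(1)[OF assms(1,2)]] unfolding race_Suc_diff
    by (meson mult_nonneg_nonneg not_less)
  then show ?thesis ..
qed

lemma floor_scaling:
  fixes e :: "nat \<Rightarrow> real"
  assumes "e \<longlonglongrightarrow> 0" "\<And>k. 0 < e k" "0 < L"
  shows "(\<lambda>k. real (nat \<lfloor>L / e k\<rfloor>) * e k) \<longlonglongrightarrow> L"
proof (rule tendsto_sandwich)
  have "(\<lambda>k. L - e k) \<longlonglongrightarrow> L - 0" by (intro tendsto_intros assms)
  then show "(\<lambda>k. L - e k) \<longlonglongrightarrow> L" by simp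
  have fl: "real (nat \<lfloor>L / e k\<rfloor>) = of_int \<lfloor>L / e k\<rfloor>" for k
    using assms(2)[of k] assms(3) by simp
  show "eventually (\<lambda>k. L - e k \<le> real (nat \<lfloor>L / e k\<rfloor>) * e k) sequentially"
  proof (rule always_eventually, rule allI)
    fix k
    have "L / e k - 1 \<le> of_int \<lfloor>L / e k\<rfloor>" by linarith
    then have "(L / e k - 1) * e k \<le> of_int \<lfloor>L / e k\<rfloor> * e k"
      using assms(2)[of k] by (intro mult_right_mono) auto
    then show "L - e k \<le> real (nat \<lfloor>L / e k\<rfloor>) * e k"
      using assms(2)[of k] unfolding fl by (simp add: left_diff_distrib)
  qed
  show "eventually (\<lambda>k. real (nat \<lfloor>L / e k\<rfloor>) * e k \<le> L) sequentially"
    using assms(2) unfolding fl by (intro always_eventually allI) (simp add: pos_le_divide_eq[symmetric])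
qed simp

lemma critical_curvature:
  assumes "r \<ge> 2"
  shows "kernel_curvature (1 / (2 * real r)) r = (real r - 1) * (2 * real r - 1) / (24 * (real r)\<^sup>2)"
  using assms unfolding kernel_curvature_eq
  by (simp add: field_simps power2_eq_square power3_eq_cube)

section \<open>The critical regime\<close>

locale critical_sequence =
  fixes r :: nat and \<alpha> :: "nat \<Rightarrow> real" and N :: "nat \<Rightarrow> nat"
  assumes r: "r \<ge> 2"
    and \<alpha>: "\<alpha> \<longlonglongrightarrow> 1 / (2 * real r)" "\<And>k. 1 / (2 * real r) < \<alpha> k" "\<And>k. \<alpha> k < 1"
    and mode: "\<And>k. unimodal_with_mode (race (\<alpha> k) r) (N k)"
begin

definition e where "e k = \<alpha> k - 1 / (2 * real r)"

lemma e_pos: "0 < e k" and e_tendsto: "e \<longlonglongrightarrow> 0"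
proof -
  show "0 < e k" using \<alpha>(2)[of k] by (simp add: e_def)
  have "(\<lambda>k. \<alpha> k - 1 / (2 * real r)) \<longlonglongrightarrow> 1 / (2 * real r) - 1 / (2 * real r)"
    by (intro tendsto_intros \<alpha>)
  then show "e \<longlonglongrightarrow> 0" by (simp add: e_def[abs_def])
qed

lemma scaling:
  assumes "0 < L" "(\<lambda>k. real (n k) * e k) \<longlonglongrightarrow> L"
  shows "race_scaling \<alpha> (\<lambda>k. sqrt (e k)) e n (1 / (2 * real r)) L (real r) 1 r"
proof
  have "0 < 1 / (2 * real r)" using r by simp
  then show "0 < \<alpha> k" for k using \<alpha>(2)[of k] by linarith
  show "(\<lambda>k. sqrt (e k)) \<longlonglongrightarrow> 0"
    using tendsto_real_sqrt[OF e_tendsto] by simp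
  show "(\<lambda>k. real (n k) * (sqrt (e k))\<^sup>2) \<longlonglongrightarrow> L"
    using assms e_pos by (simp add: less_imp_le)
  have "(real r * \<alpha> k - 1 / 2) / e k = real r" for k
    using e_pos[of k] r by (simp add: e_def field_simps)
  then show "(\<lambda>k. (real r * \<alpha> k - 1 / 2) / e k) \<longlonglongrightarrow> real r" by simp
  have "(sqrt (e k))\<^sup>2 / e k = 1" for k using e_pos[of k] by simp
  then show "(\<lambda>k. (sqrt (e k))\<^sup>2 / e k) \<longlonglongrightarrow> 1" by simp
qed (use r \<alpha> e_pos assms in auto)

definition mode_const where "mode_const = (real r - 1) / (4 * real r)"

lemma mode_const_pos: "0 < mode_const" using r by (simp add: mode_const_def)

lemma variance_eq:
  "(1 / (2 * real r)) * (1 - 1 / (2 * real r)) = (2 * real r - 1) / (4 * (real r)\<^sup>2)"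
  using r by (simp add: field_simps power2_eq_square)

lemma drift_sign:
  assumes "0 < L"
  shows "real r - 3 * (1 * kernel_curvature (1 / (2 * real r)) r) /
      (2 * (L * ((1 / (2 * real r)) * (1 - 1 / (2 * real r))))) = real r * (L - mode_const) / L"
proof -
  have "0 < 2 * real r - 1" using r by simp
  then show ?thesis
    unfolding variance_eq critical_curvature[OF r] mode_const_def using r assms
    by (simp add: field_simps power2_eq_square)
qed

lemma drift_tendsto:
  assumes "0 < L"
  shows "\<exists>C>0. (\<lambda>k. (race (\<alpha> k) r (nat \<lfloor>L / e k\<rfloor>) - race (\<alpha> k) r (Suc (nat \<lfloor>L / e k\<rfloor>))) / (sqrt (e k) ^ 3 * e k))
    \<longlonglongrightarrow> C * (L - mode_const)"
proof -
  interpret race_scaling \<alpha> "\<lambda>k. sqrt (e k)" e "\<lambda>k. nat \<lfloor>L / e k\<rfloor>" "1 / (2 * real r)" L "real r" 1 r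
    by (rule scaling[OF assms floor_scaling[OF e_tendsto e_pos assms]])
  have "0 < \<sigma> / (4 * (L * \<sigma>) * sqrt (pi * (L * \<sigma>))) * real r / L"
    using \<sigma>_pos assms r by simp
  moreover have "\<sigma> / (4 * (L * \<sigma>) * sqrt (pi * (L * \<sigma>))) *
      (real r - 3 * (1 * kernel_curvature (1 / (2 * real r)) r) / (2 * (L * \<sigma>)))
      = \<sigma> / (4 * (L * \<sigma>) * sqrt (pi * (L * \<sigma>))) * real r / L * (L - mode_const)"
    using drift_sign[OF assms, folded \<sigma>_def] by simp
  ultimately show ?thesis using race_diff_tendsto by auto
qed

lemma scale_pos: "0 < sqrt (e k) ^ 3 * e k"
  using e_pos by simp

lemma mode_le:
  assumes "mode_const < L"
  shows "eventually (\<lambda>k. real (N k) * e k \<le> L) sequentially"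
proof -
  have L: "0 < L" using assms mode_const_pos by linarith
  obtain C where C: "C > 0" and lim: "(\<lambda>k. (race (\<alpha> k) r (nat \<lfloor>L / e k\<rfloor>) -
      race (\<alpha> k) r (Suc (nat \<lfloor>L / e k\<rfloor>))) / (sqrt (e k) ^ 3 * e k)) \<longlonglongrightarrow> C * (L - mode_const)"
    using drift_tendsto[OF L] by blast
  have "0 < C * (L - mode_const)" using C assms by simp
  from order_tendstoD(1)[OF lim this] show ?thesis
  proof eventually_elim
    case (elim k)
    then have "race (\<alpha> k) r (Suc (nat \<lfloor>L / e k\<rfloor>)) < race (\<alpha> k) r (nat \<lfloor>L / e k\<rfloor>)"
      using scale_pos[of k] unfolding zero_less_divide_iff by linarith
    then have "N k \<le> nat \<lfloor>L / e k\<rfloor>" by (rule unimodal_mode_le[OF mode])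
    then have "real (N k) \<le> L / e k" using e_pos[of k] L by (simp add: le_nat_iff le_floor_iff)
    then show ?case using e_pos[of k] by (simp add: pos_le_divide_eq)
  qed
qed

lemma mode_ge:
  assumes "0 < L" "L < mode_const"
  shows "eventually (\<lambda>k. L \<le> real (N k) * e k) sequentially"
proof -
  obtain C where C: "C > 0" and lim: "(\<lambda>k. (race (\<alpha> k) r (nat \<lfloor>L / e k\<rfloor>) -
      race (\<alpha> k) r (Suc (nat \<lfloor>L / e k\<rfloor>))) / (sqrt (e k) ^ 3 * e k)) \<longlonglongrightarrow> C * (L - mode_const)"
    using drift_tendsto[OF assms(1)] by blast
  have "C * (L - mode_const) < 0" using C assms by (simp add: mult_pos_neg)
  from order_tendstoD(2)[OF lim this] show ?thesis
  proof eventually_elim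
    case (elim k)
    then have "race (\<alpha> k) r (nat \<lfloor>L / e k\<rfloor>) < race (\<alpha> k) r (Suc (nat \<lfloor>L / e k\<rfloor>))"
      using scale_pos[of k] unfolding divide_less_0_iff by linarith
    then have "nat \<lfloor>L / e k\<rfloor> < N k" by (rule unimodal_less_mode[OF mode])
    then have "L / e k \<le> real (N k)" by linarith
    then show ?case using e_pos[of k] by (simp add: pos_divide_le_eq)
  qed
qed

lemma mode_tendsto: "(\<lambda>k. real (N k) * e k) \<longlonglongrightarrow> mode_const"
proof (rule order_tendstoI)
  fix b assume "mode_const < b"
  then obtain L where "mode_const < L" "L < b" using dense by blast
  then show "eventually (\<lambda>k. real (N k) * e k < b) sequentially"
    using mode_le[of L] by (auto elim!: eventually_mono)
next
  fix b assume "b < mode_const"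
  then obtain L where "max b 0 < L" "L < mode_const" using dense[of "max b 0" mode_const] mode_const_pos by auto
  then show "eventually (\<lambda>k. b < real (N k) * e k) sequentially"
    using mode_ge[of L] by (auto elim!: eventually_mono)
qed

lemma maximum_tendsto:
  "(\<lambda>k. (race (\<alpha> k) r (N k) - 1 / 2) / (sqrt (e k) * e k)) \<longlonglongrightarrow>
     4 / 3 * sqrt (real r ^ 5 / (pi * (2 * real r - 1) * (real r - 1)))"
proof -
  interpret race_scaling \<alpha> "\<lambda>k. sqrt (e k)" e N "1 / (2 * real r)" mode_const "real r" 1 r
    by (rule scaling[OF mode_const_pos mode_tendsto])
  have pos: "0 < 2 * real r - 1" "0 < real r - 1" "0 < real r" using r by auto
  define b where "b = mode_const * \<sigma>"
  have b: "b = (real r - 1) * (2 * real r - 1) / (16 * real r ^ 3)"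
    unfolding b_def \<sigma>_def variance_eq mode_const_def using pos
    by (simp add: power3_eq_cube power2_eq_square)
  have "1 * (t / (24 * x\<^sup>2)) / (2 * (t / (16 * x ^ 3))) = x / 3" if "0 < t" "0 < x" for t x :: real
    using that by (simp add: field_simps power3_eq_cube power2_eq_square)
  from this[of "(real r - 1) * (2 * real r - 1)" "real r"]
  have drift: "real r - 1 * kernel_curvature (1 / (2 * real r)) r / (2 * b) = 2 * real r / 3"
    unfolding b critical_curvature[OF r] using pos by simp
  have scale: "2 * real r / 3 / (2 * sqrt (pi * b)) = 4 / 3 * sqrt (real r ^ 5 / (pi * (2 * real r - 1) * (real r - 1)))"
  proof -
    have "x ^ 5 / (pi * t) = x\<^sup>2 / (4\<^sup>2 * (pi * (t / (16 * x ^ 3))))" if "0 < t" "0 < x" for t x :: real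
      using that by (simp add: eval_nat_numeral)
    from this[of "(real r - 1) * (2 * real r - 1)" "real r"]
    have "real r ^ 5 / (pi * (2 * real r - 1) * (real r - 1)) = (real r)\<^sup>2 / (4\<^sup>2 * (pi * b))"
      unfolding b using pos by (simp add: mult_ac)
    then have "sqrt (real r ^ 5 / (pi * (2 * real r - 1) * (real r - 1))) = real r / (4 * sqrt (pi * b))"
      by (simp only: real_sqrt_divide real_sqrt_mult[of "4\<^sup>2"] real_sqrt_abs)
    then show ?thesis by simp
  qed
  show ?thesis
    using race_tendsto unfolding b_def[symmetric] drift scale .
qed

end

theorem theorem3:
  fixes r :: nat
    and M :: "real \<Rightarrow> 'a measure"
    and X X' :: "real \<Rightarrow> nat \<Rightarrow> 'a \<Rightarrow> real"
    and p :: "real \<Rightarrow> nat \<Rightarrow> real"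
  assumes "r \<ge> 2"
    and "\<And>\<alpha>. 0 < \<alpha> \<Longrightarrow> \<alpha> < 1 \<Longrightarrow> iid_bernoulli (M \<alpha>) \<alpha> (X \<alpha>) (X' \<alpha>)"
  defines "p \<equiv> \<lambda>\<alpha>. win_prob (M \<alpha>) (X \<alpha>) (X' \<alpha>) r 1"
  shows "(\<forall>\<alpha>. 0 < \<alpha> \<and> \<alpha> \<le> 1 / (2 * real r) \<longrightarrow> strict_mono (p \<alpha>)) \<and>
    (\<forall>\<alpha>. 1 / (2 * real r) < \<alpha> \<and> \<alpha> \<le> 1 / (real r + 1) \<longrightarrow> (\<exists>N. unimodal_with_mode (p \<alpha>) N)) \<and>
    (\<forall>\<alpha>. 1 / (real r + 1) < \<alpha> \<and> \<alpha> < 1 \<longrightarrow> strict_antimono_on UNIV (p \<alpha>)) \<and>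
    (\<forall>N. (\<forall>\<alpha>. 1 / (2 * real r) < \<alpha> \<and> \<alpha> \<le> 1 / (real r + 1) \<longrightarrow> unimodal_with_mode (p \<alpha>) (N \<alpha>)) \<longrightarrow>
      (\<lambda>\<alpha>. real (N \<alpha>)) \<sim>[at_right (1 / (2 * real r))]
        (\<lambda>\<alpha>. (real r - 1) / (4 * real r) * inverse (\<alpha> - 1 / (2 * real r))) \<and>
      (\<lambda>\<alpha>. p \<alpha> (N \<alpha>) - 1 / 2) \<sim>[at_right (1 / (2 * real r))]
        (\<lambda>\<alpha>. 4 / 3 * sqrt (real r ^ 5 / (pi * (2 * real r - 1) * (real r - 1)))
              * (\<alpha> - 1 / (2 * real r)) powr (3 / 2)))"
proof -
  have half: "0 < 1 / (2 * real r)" "1 / (2 * real r) < 1 / (real r + 1)" "1 / (real r + 1) < 1"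
    using \<open>r \<ge> 2\<close> by (simp_all add: field_simps)
  have p_eq: "p \<alpha> = race \<alpha> r" if "0 < \<alpha>" "\<alpha> < 1" for \<alpha>
    using win_prob_eq_binom_mean[OF assms(2)[OF that], of r 1]
    by (simp add: p_def race_def fun_eq_iff)
  have i: "strict_mono (p \<alpha>)" if "0 < \<alpha>" "\<alpha> \<le> 1 / (2 * real r)" for \<alpha>
  proof -
    have a1: "\<alpha> < 1" using that half by linarith
    have "0 < race \<alpha> r (Suc n) - race \<alpha> r n" for n
      unfolding race_Suc_diff
      by (intro mult_pos_pos[OF variance_bounds(1)] race_incr_pos that a1 assms(1))
    then show ?thesis by (simp add: p_eq that a1 strict_mono_Suc_iff)
  qed
  have ii: "\<exists>N. unimodal_with_mode (p \<alpha>) N"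
    if "1 / (2 * real r) < \<alpha>" "\<alpha> \<le> 1 / (real r + 1)" for \<alpha>
  proof -
    have \<alpha>: "0 < \<alpha>" "\<alpha> < 1" using that half by linarith+
    have "1 / 2 < real r * \<alpha>" using that(1) assms(1) by (simp add: field_simps)
    then obtain m where m: "race_incr \<alpha> r m < 0"
      using race_incr_eventually_neg[OF \<alpha>] by blast
    have "0 \<le> race_incr \<alpha> r 0"
    proof (subst race_incr_0)
      show "0 \<le> (1 - \<alpha>) ^ (r - 1) * (1 - (real r + 1) * \<alpha>)"
        using \<alpha> that(2) by (intro mult_nonneg_nonneg) (auto simp: field_simps)
    qed (use assms(1) in simp)
    then show ?thesis
      unfolding p_eq[OF \<alpha>] using m race_Suc_diff variance_bounds(1)[OF \<alpha>]
      by (intro unimodal_if_sign_change[where u = "race_incr \<alpha> r"] race_incr_neg_Suc[OF assms(1) \<alpha>])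
  qed
  have iii: "strict_antimono_on UNIV (p \<alpha>)" if "1 / (real r + 1) < \<alpha>" "\<alpha> < 1" for \<alpha>
  proof -
    have a0: "0 < \<alpha>" using that half by linarith
    have "race \<alpha> r (Suc n) - race \<alpha> r n < 0" for n
      unfolding race_Suc_diff
      by (rule mult_pos_neg[OF variance_bounds(1)[OF a0 that(2)] race_incr_neg]) (use that assms(1) in auto)
    then show ?thesis
      using less_if_steps_less[of _ _ "\<lambda>n. - race \<alpha> r n"]
      by (auto simp: p_eq[OF a0 that(2)] intro!: monotone_onI)
  qed
  have iv: "(\<lambda>\<alpha>. real (N \<alpha>)) \<sim>[at_right (1 / (2 * real r))]
        (\<lambda>\<alpha>. (real r - 1) / (4 * real r) * inverse (\<alpha> - 1 / (2 * real r)))" (is ?mode)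
    and v: "(\<lambda>\<alpha>. p \<alpha> (N \<alpha>) - 1 / 2) \<sim>[at_right (1 / (2 * real r))]
        (\<lambda>\<alpha>. 4 / 3 * sqrt (real r ^ 5 / (pi * (2 * real r - 1) * (real r - 1)))
              * (\<alpha> - 1 / (2 * real r)) powr (3 / 2))" (is ?maximum)
    if N: "\<forall>\<alpha>. 1 / (2 * real r) < \<alpha> \<and> \<alpha> \<le> 1 / (real r + 1) \<longrightarrow> unimodal_with_mode (p \<alpha>) (N \<alpha>)" for N
  proof -
    let ?a = "1 / (2 * real r)"
    let ?C = "4 / 3 * sqrt (real r ^ 5 / (pi * (2 * real r - 1) * (real r - 1)))"
    have crit: "critical_sequence r S (\<lambda>k. N (S k))"
      if S: "\<And>k. ?a < S k" "\<And>k. S k < 1 / (real r + 1)" "S \<longlonglongrightarrow> ?a" for S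
    proof
      show "S k < 1" for k using S(2)[of k] half by linarith
      show "unimodal_with_mode (race (S k) r) (N (S k))" for k
      proof -
        have "0 < S k" "S k < 1" using S(1,2)[of k] half by linarith+
        then show ?thesis using N S(1,2)[of k] p_eq[of "S k"] by (metis less_imp_le)
      qed
    qed (rule assms(1) S)+
    have "((\<lambda>\<alpha>. real (N \<alpha>) * (\<alpha> - ?a)) \<longlongrightarrow> (real r - 1) / (4 * real r)) (at_right ?a)"
    proof (rule tendsto_at_right_sequentially[OF half(2)])
      fix S assume S: "\<And>k. ?a < S k" "\<And>k. S k < 1 / (real r + 1)" "S \<longlonglongrightarrow> ?a"
      interpret critical_sequence r S "\<lambda>k. N (S k)" by (rule crit[OF S])
      show "(\<lambda>k. real (N (S k)) * (S k - ?a)) \<longlonglongrightarrow> (real r - 1) / (4 * real r)"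
        using mode_tendsto unfolding e_def mode_const_def .
    qed
    then have "((\<lambda>\<alpha>. real (N \<alpha>) * (\<alpha> - ?a) / ((real r - 1) / (4 * real r))) \<longlongrightarrow>
        (real r - 1) / (4 * real r) / ((real r - 1) / (4 * real r))) (at_right ?a)"
      by (intro tendsto_divide tendsto_const) (use assms(1) in auto)
    then show ?mode
      using assms(1) by (intro asymp_equivI') (simp add: field_simps)
    have "((\<lambda>\<alpha>. (p \<alpha> (N \<alpha>) - 1 / 2) / (\<alpha> - ?a) powr (3 / 2)) \<longlongrightarrow> ?C) (at_right ?a)"
    proof (rule tendsto_at_right_sequentially[OF half(2)])
      fix S assume S: "\<And>k. ?a < S k" "\<And>k. S k < 1 / (real r + 1)" "S \<longlonglongrightarrow> ?a"
      interpret critical_sequence r S "\<lambda>k. N (S k)" by (rule crit[OF S])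
      have "(S k - ?a) powr (3 / 2) = sqrt (e k) * e k" for k
        using powr_add[of "e k" "1 / 2" 1] e_pos[of k] by (simp add: e_def[symmetric] powr_half_sqrt)
      moreover have "p (S k) = race (S k) r" for k
        using S(1,2)[of k] half by (intro p_eq) linarith+
      ultimately show "(\<lambda>k. (p (S k) (N (S k)) - 1 / 2) / (S k - ?a) powr (3 / 2)) \<longlonglongrightarrow> ?C"
        using maximum_tendsto by simp
    qed
    moreover have "?C \<noteq> 0" using assms(1) by simp
    ultimately have "((\<lambda>\<alpha>. (p \<alpha> (N \<alpha>) - 1 / 2) / (\<alpha> - ?a) powr (3 / 2) / ?C) \<longlongrightarrow> ?C / ?C) (at_right ?a)"
      by (intro tendsto_divide tendsto_const)
    then show ?maximum
      using \<open>?C \<noteq> 0\<close> by (intro asymp_equivI') (simp add: mult.commute)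
  qed
  show ?thesis
  proof (intro conjI allI impI)
    show "strict_mono (p \<alpha>)" if "0 < \<alpha> \<and> \<alpha> \<le> 1 / (2 * real r)" for \<alpha>
      using i that by simp
    show "\<exists>N. unimodal_with_mode (p \<alpha>) N" if "1 / (2 * real r) < \<alpha> \<and> \<alpha> \<le> 1 / (real r + 1)" for \<alpha>
      using ii[of \<alpha>] that by simp
    show "strict_antimono_on UNIV (p \<alpha>)" if "1 / (real r + 1) < \<alpha> \<and> \<alpha> < 1" for \<alpha>
      using iii[of \<alpha>] that by simp
  qed (rule iv v; assumption)+
qed

end
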